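(* Let $X=c_0$ or $X=\ell_p$ with $1\le p<\infty$ (complex sequence spaces), and let $P:X\to X$ be the $2$-homogeneous polynomial $P(x)=x_1B(x)$, where $B:X\to X$, $B(x_1,x_2,x_3,\dots)=(x_2,x_3,\dots)$, is the backward shift. Let $J_P$ be the Julia set of $P$ and $r_P$ its limit radius. Then $P|_{J_P}:J_P\to J_P$ is chaotic and, if $x_0\in J_P$ is any vector such that $Orb_P(x_0)$ is dense in $J_P$, then: (1) $x_0$ is a weakly hypercyclic vector for $P$; (2) $x_0$ is a $d$-hypercyclic vector for $P$ for every $d>r_P$; (3) $x_0$ is a $\Gamma$-supercyclic vector for $P$ for every $\Gamma\subset\mathbb C$ such that $0$ is an accumulation point of $\Gamma$. Moreover, $P$ is also $\Gamma$-supercyclic for every unbounded set $\Gamma\subset\mathbb C$.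
   Context: For a continuous $m$-homogeneous polynomial $P$ ($m\ge2$) on a normed space $X$, $\|P\|=\sup_{\|x\|\le1}\|P(x)\|$ and the limit radius is $r_P=\|P\|^{1/(1-m)}$. Put $A_P=\{x\in X: P^n(x)\to0\}$ (an open set, where $P^n$ denotes the $n$-th iterate). The Julia set is $J_P=\partial A_P$ (topological boundary); it is closed and $P$-invariant. The orbit of $x$ is $Orb_P(x)=\{P^n(x):n\in\mathbb N_0\}$. A continuous self-map of a metric space is chaotic if it has a dense orbit and its periodic points are dense. A vector $x$ is weakly hypercyclic for $P$ if $Orb_P(x)$ is dense in $X$ for the weak topology; it is $d$-hypercyclic ($d>0$) if for every $y\in X$ there is $z\in Orb_P(x)$ with $\|y-z\|<d$; it is $\Gamma$-supercyclic ($\Gamma\subseteq\mathbb C$) if $\Gamma\cdot Orb_P(x)=\{\gamma z:\gamma\in\Gamma,\ z\in Orb_P(x)\}$ is dense in $X$. $P$ is $\Gamma$-supercyclic if it has a $\Gamma$-supercyclic vector. *)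

theory Defs
  imports "HOL-Analysis.Analysis"
begin

section \<open>The complex sequence spaces\<close>

text \<open>
  A normed sequence space is given by its carrier \<open>X\<close>, a linear subspace of
  \<open>nat \<Rightarrow> complex\<close> with pointwise operations, together with its norm \<open>N\<close>, which is only
  meaningful on \<open>X\<close>.  Sequences are indexed from 0: the \<open>k\<close>-th coordinate of the usual
  notation \<open>(x\<^sub>1, x\<^sub>2, \<dots>)\<close> is \<open>x (k - 1)\<close>.
\<close>

type_synonym cseq = "nat \<Rightarrow> complex"

definition c0_space :: "cseq set" where
  "c0_space = {x. x \<longlonglongrightarrow> 0}"

definition c0_norm :: "cseq \<Rightarrow> real" where
  "c0_norm x = (SUP i. cmod (x i))"

definition lp_space :: "real \<Rightarrow> cseq set" where
  "lp_space p = {x. summable (\<lambda>i. cmod (x i) powr p)}"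

definition lp_norm :: "real \<Rightarrow> cseq \<Rightarrow> real" where
  "lp_norm p x = (\<Sum>i. cmod (x i) powr p) powr (1 / p)"

text \<open>
  \<open>Metric_space\<close> demands nonnegativity and symmetry of the distance also off the carrier,
  where \<open>N\<close> is unspecified; hence the value 0 there.
\<close>

definition norm_dist :: "cseq set \<Rightarrow> (cseq \<Rightarrow> real) \<Rightarrow> cseq \<Rightarrow> cseq \<Rightarrow> real" where
  "norm_dist X N x y = (if x \<in> X \<and> y \<in> X then N (\<lambda>i. x i - y i) else 0)"

definition norm_topology :: "cseq set \<Rightarrow> (cseq \<Rightarrow> real) \<Rightarrow> cseq topology" where
  "norm_topology X N = Metric_space.mtopology X (norm_dist X N)"

text \<open>Values of a functional outside \<open>X\<close> are irrelevant.\<close>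

definition continuous_functional :: "cseq set \<Rightarrow> (cseq \<Rightarrow> real) \<Rightarrow> (cseq \<Rightarrow> complex) \<Rightarrow> bool" where
  "continuous_functional X N \<phi> \<longleftrightarrow>
     (\<forall>x\<in>X. \<forall>y\<in>X. \<forall>a b. \<phi> (\<lambda>i. a * x i + b * y i) = a * \<phi> x + b * \<phi> y) \<and>
     continuous_map (norm_topology X N) euclidean \<phi>"

definition weak_topology :: "cseq set \<Rightarrow> (cseq \<Rightarrow> real) \<Rightarrow> cseq topology" where
  "weak_topology X N =
     topology_generated_by
       {{x \<in> X. \<phi> x \<in> U} | \<phi> U. continuous_functional X N \<phi> \<and> open U}"

section \<open>Dynamics of self-maps\<close>

definition Orb :: "('a \<Rightarrow> 'a) \<Rightarrow> 'a \<Rightarrow> 'a set" where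
  "Orb f x = {(f ^^ n) x | n. True}"

definition dense_in :: "'a topology \<Rightarrow> 'a set \<Rightarrow> bool" where
  "dense_in T S \<longleftrightarrow> S \<subseteq> topspace T \<and> T closure_of S = topspace T"

definition periodic_points :: "'a topology \<Rightarrow> ('a \<Rightarrow> 'a) \<Rightarrow> 'a set" where
  "periodic_points T f = {x \<in> topspace T. \<exists>n>0. (f ^^ n) x = x}"

definition chaotic :: "'a topology \<Rightarrow> ('a \<Rightarrow> 'a) \<Rightarrow> bool" where
  "chaotic T f \<longleftrightarrow>
     continuous_map T T f \<and>
     (\<exists>x\<in>topspace T. dense_in T (Orb f x)) \<and>
     dense_in T (periodic_points T f)"

section \<open>Homogeneous polynomials\<close>

definition poly_norm :: "cseq set \<Rightarrow> (cseq \<Rightarrow> real) \<Rightarrow> (cseq \<Rightarrow> cseq) \<Rightarrow> real" where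
  "poly_norm X N P = (SUP x\<in>{x \<in> X. N x \<le> 1}. N (P x))"

text \<open>The parameter \<open>m\<close> is the degree of homogeneity of \<open>P\<close>.\<close>

definition limit_radius :: "nat \<Rightarrow> cseq set \<Rightarrow> (cseq \<Rightarrow> real) \<Rightarrow> (cseq \<Rightarrow> cseq) \<Rightarrow> real" where
  "limit_radius m X N P = poly_norm X N P powr (1 / (1 - real m))"

definition attraction_set :: "cseq set \<Rightarrow> (cseq \<Rightarrow> real) \<Rightarrow> (cseq \<Rightarrow> cseq) \<Rightarrow> cseq set" where
  "attraction_set X N P =
     {x \<in> X. limitin (norm_topology X N) (\<lambda>n. (P ^^ n) x) (\<lambda>_. 0) sequentially}"

definition julia_set :: "cseq set \<Rightarrow> (cseq \<Rightarrow> real) \<Rightarrow> (cseq \<Rightarrow> cseq) \<Rightarrow> cseq set" where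
  "julia_set X N P = norm_topology X N frontier_of attraction_set X N P"

definition weakly_hypercyclic_vector ::
    "cseq set \<Rightarrow> (cseq \<Rightarrow> real) \<Rightarrow> (cseq \<Rightarrow> cseq) \<Rightarrow> cseq \<Rightarrow> bool" where
  "weakly_hypercyclic_vector X N P x \<longleftrightarrow> x \<in> X \<and> dense_in (weak_topology X N) (Orb P x)"

definition d_hypercyclic_vector ::
    "real \<Rightarrow> cseq set \<Rightarrow> (cseq \<Rightarrow> real) \<Rightarrow> (cseq \<Rightarrow> cseq) \<Rightarrow> cseq \<Rightarrow> bool" where
  "d_hypercyclic_vector d X N P x \<longleftrightarrow>
     0 < d \<and> x \<in> X \<and> (\<forall>y\<in>X. \<exists>z\<in>Orb P x. N (\<lambda>i. y i - z i) < d)"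

definition supercyclic_vector ::
    "complex set \<Rightarrow> cseq set \<Rightarrow> (cseq \<Rightarrow> real) \<Rightarrow> (cseq \<Rightarrow> cseq) \<Rightarrow> cseq \<Rightarrow> bool" where
  "supercyclic_vector \<Gamma> X N P x \<longleftrightarrow>
     x \<in> X \<and> dense_in (norm_topology X N) {(\<lambda>i. \<gamma> * z i) | \<gamma> z. \<gamma> \<in> \<Gamma> \<and> z \<in> Orb P x}"

definition supercyclic ::
    "complex set \<Rightarrow> cseq set \<Rightarrow> (cseq \<Rightarrow> real) \<Rightarrow> (cseq \<Rightarrow> cseq) \<Rightarrow> bool" where
  "supercyclic \<Gamma> X N P \<longleftrightarrow> (\<exists>x. supercyclic_vector \<Gamma> X N P x)"

definition backward_shift :: "cseq \<Rightarrow> cseq" where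
  "backward_shift x = (\<lambda>i. x (Suc i))"

definition shift_poly :: "cseq \<Rightarrow> cseq" where
  "shift_poly x = (\<lambda>i. x 0 * backward_shift x i)"

section \<open>Well-definedness\<close>

text \<open>
  \<open>Metric_space.mtopology\<close> is only meaningful when the distance is a metric; the following
  facts establish this for the spaces above.
\<close>

lemma c0_bdd: "x \<in> c0_space \<Longrightarrow> bdd_above (range (\<lambda>i. cmod (x i)))"
  unfolding c0_space_def
  by (metis (mono_tags) convergentI convergent_imp_Bseq Bseq_eq_bounded bounded_imp_bdd_above
      bounded_norm_comp mem_Collect_eq)

lemma c0_le_norm: "x \<in> c0_space \<Longrightarrow> cmod (x i) \<le> c0_norm x"
  unfolding c0_norm_def by (rule cSUP_upper[OF _ c0_bdd]) auto

lemma c0_diff: "x \<in> c0_space \<Longrightarrow> y \<in> c0_space \<Longrightarrow> (\<lambda>i. x i - y i) \<in> c0_space"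
  unfolding c0_space_def using tendsto_diff[of x 0 sequentially y 0] by simp

lemma c0_norm_triangle:
  assumes "x \<in> c0_space" "y \<in> c0_space"
  shows "c0_norm (\<lambda>i. x i + y i) \<le> c0_norm x + c0_norm y"
  unfolding c0_norm_def
proof (rule cSUP_least)
  fix i
  have "cmod (x i + y i) \<le> cmod (x i) + cmod (y i)" by (rule norm_triangle_ineq)
  also have "\<dots> \<le> c0_norm x + c0_norm y" using assms c0_le_norm by (intro add_mono) auto
  finally show "cmod (x i + y i) \<le> (SUP i. cmod (x i)) + (SUP i. cmod (y i))"
    by (simp add: c0_norm_def)
qed auto

lemma c0_norm_eq_0:
  assumes "x \<in> c0_space" "c0_norm x = 0" shows "x i = 0"
  using c0_le_norm[OF assms(1), of i] assms(2) by simp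

lemma Metric_space_normI:
  assumes diff: "\<And>x y. x \<in> X \<Longrightarrow> y \<in> X \<Longrightarrow> (\<lambda>i. x i - y i) \<in> X"
    and nonneg: "\<And>x. x \<in> X \<Longrightarrow> 0 \<le> N x"
    and comm: "\<And>x y. N (\<lambda>i. x i - y i) = N (\<lambda>i. y i - x i)"
    and zero: "N (\<lambda>_. 0) = 0" "\<And>x i. x \<in> X \<Longrightarrow> N x = 0 \<Longrightarrow> x i = 0"
    and tri: "\<And>x y. x \<in> X \<Longrightarrow> y \<in> X \<Longrightarrow> N (\<lambda>i. x i + y i) \<le> N x + N y"
  shows "Metric_space X (norm_dist X N)"
proof
  fix x y z :: cseq
  show "0 \<le> norm_dist X N x y" by (simp add: norm_dist_def diff nonneg)
  show "norm_dist X N x y = norm_dist X N y x" using comm by (auto simp: norm_dist_def)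
  show "norm_dist X N x y = 0 \<longleftrightarrow> x = y" if "x \<in> X" "y \<in> X"
    using zero(1) zero(2)[OF diff[OF that]] that by (auto simp: norm_dist_def)
  show "norm_dist X N x z \<le> norm_dist X N x y + norm_dist X N y z"
    if "x \<in> X" "y \<in> X" "z \<in> X"
    using tri[OF diff[OF that(1,2)] diff[OF that(2,3)]] that by (simp add: norm_dist_def)
qed

lemma Metric_space_c0: "Metric_space c0_space (norm_dist c0_space c0_norm)"
proof (rule Metric_space_normI)
  show "0 \<le> c0_norm x" if "x \<in> c0_space" for x
    using c0_le_norm[OF that, of 0] norm_ge_zero order_trans by blast
  show "c0_norm (\<lambda>i. x i - y i) = c0_norm (\<lambda>i. y i - x i)" for x y
    by (simp add: c0_norm_def norm_minus_commute)
  show "c0_norm (\<lambda>_. 0) = 0" by (simp add: c0_norm_def)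
qed (use c0_diff c0_norm_eq_0 c0_norm_triangle in auto)

lemma convex_powr_ineq:
  fixes p :: real
  assumes "p \<ge> 1" "0 \<le> s" "0 \<le> t" "0 \<le> a" "0 \<le> b" "a + b = 1"
  shows "(a * s + b * t) powr p \<le> a * s powr p + b * t powr p"
proof -
  have pw: "c powr p \<le> c" if "0 \<le> c" "c \<le> 1" for c :: real
    using powr_mono'[of 1 p c] assms(1) that by simp
  have ab: "a \<le> 1" "b \<le> 1" using assms by auto
  show ?thesis
  proof (cases "s = 0 \<or> t = 0")
    case True
    then show ?thesis
      using pw[of a] pw[of b] ab assms by (auto simp: powr_mult intro!: mult_right_mono)
  next
    case False
    then show ?thesis
      using powr_convex[OF assms(1)] assms unfolding convex_on_def by auto
  qed
qed

lemma lp_norm_nonneg: "0 \<le> lp_norm p x"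
  by (simp add: lp_norm_def)

lemma lp_norm_powr:
  assumes "p \<ge> 1" "x \<in> lp_space p"
  shows "lp_norm p x powr p = (\<Sum>i. cmod (x i) powr p)"
  using assms by (simp add: lp_norm_def lp_space_def powr_powr suminf_nonneg)

lemma lp_norm_eq_0:
  assumes "p \<ge> 1" "x \<in> lp_space p" "lp_norm p x = 0" shows "x i = 0"
proof -
  have "(\<Sum>i. cmod (x i) powr p) = 0" using lp_norm_powr[OF assms(1,2)] assms by simp
  then show ?thesis
    using assms(2) suminf_eq_zero_iff[of "\<lambda>i. cmod (x i) powr p"] by (simp add: lp_space_def)
qed

lemma lp_minkowski:
  assumes p: "p \<ge> 1" and x: "x \<in> lp_space p" and y: "y \<in> lp_space p"
  shows "(\<lambda>i. x i + y i) \<in> lp_space p \<and> lp_norm p (\<lambda>i. x i + y i) \<le> lp_norm p x + lp_norm p y"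
proof -
  define A B where "A = lp_norm p x" and "B = lp_norm p y"
  show ?thesis
  proof (cases "A = 0 \<or> B = 0")
    case True
    then have "x = (\<lambda>_. 0) \<or> y = (\<lambda>_. 0)"
      using lp_norm_eq_0[OF p x] lp_norm_eq_0[OF p y] by (auto simp: A_def B_def)
    then show ?thesis using x y lp_norm_nonneg by auto
  next
    case False
    then have AB: "A > 0" "B > 0"
      using lp_norm_nonneg[of p x] lp_norm_nonneg[of p y] by (auto simp: A_def B_def)
    define C where "C = A + B"
    have C: "C > 0" using AB by (simp add: C_def)
    define g where "g i = C powr p * (A / C * (cmod (x i) powr p / A powr p)
                          + B / C * (cmod (y i) powr p / B powr p))" for i
    have sx: "(\<lambda>i. cmod (x i) powr p) sums (A powr p)"
      using x lp_norm_powr[OF p x] by (simp add: A_def lp_space_def summable_sums)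
    have sy: "(\<lambda>i. cmod (y i) powr p) sums (B powr p)"
      using y lp_norm_powr[OF p y] by (simp add: B_def lp_space_def summable_sums)
    have "g sums (C powr p * (A / C * (A powr p / A powr p) + B / C * (B powr p / B powr p)))"
      unfolding g_def by (intro sums_mult sums_add sums_divide sx sy)
    moreover have "A / C + B / C = 1" using C by (simp add: C_def add_divide_distrib[symmetric])
    ultimately have g: "g sums (C powr p)" using AB by simp
    have le: "cmod (x i + y i) powr p \<le> g i" for i
    proof -
      have "cmod (x i + y i) powr p \<le> (cmod (x i) + cmod (y i)) powr p"
        using p by (intro powr_mono2 norm_triangle_ineq) auto
      also have "cmod (x i) + cmod (y i) = C * (A / C * (cmod (x i) / A) + B / C * (cmod (y i) / B))"
        using AB C by (simp add: field_simps)
      also have "\<dots> powr p = C powr p * (A / C * (cmod (x i) / A) + B / C * (cmod (y i) / B)) powr p"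
        using AB C by (simp add: powr_mult)
      also have "\<dots> \<le> C powr p * (A / C * (cmod (x i) / A) powr p + B / C * (cmod (y i) / B) powr p)"
        using AB C p \<open>A / C + B / C = 1\<close> by (intro mult_left_mono convex_powr_ineq) auto
      also have "\<dots> = g i" using AB by (simp add: g_def powr_divide)
      finally show ?thesis .
    qed
    have sm: "summable (\<lambda>i. cmod (x i + y i) powr p)"
      by (rule summable_comparison_test'[OF sums_summable[OF g], of 0]) (use le in auto)
    have "(\<Sum>i. cmod (x i + y i) powr p) \<le> C powr p"
      using suminf_le[OF le sm sums_summable[OF g]] sums_unique[OF g] by simp
    then have "lp_norm p (\<lambda>i. x i + y i) \<le> (C powr p) powr (1 / p)"
      unfolding lp_norm_def using p sm by (intro powr_mono2 suminf_nonneg) auto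
    also have "\<dots> = C" using p C by (simp add: powr_powr)
    finally show ?thesis using sm by (simp add: lp_space_def C_def A_def B_def)
  qed
qed

lemma lp_minus: "x \<in> lp_space p \<Longrightarrow> (\<lambda>i. - x i) \<in> lp_space p"
  by (simp add: lp_space_def)

lemma Metric_space_lp:
  assumes "p \<ge> 1"
  shows "Metric_space (lp_space p) (norm_dist (lp_space p) (lp_norm p))"
proof (rule Metric_space_normI)
  show "(\<lambda>i. x i - y i) \<in> lp_space p" if "x \<in> lp_space p" "y \<in> lp_space p" for x y
    using lp_minkowski[OF assms that(1) lp_minus[OF that(2)]] by simp
  show "lp_norm p (\<lambda>i. x i - y i) = lp_norm p (\<lambda>i. y i - x i)" for x y
    by (simp add: lp_norm_def norm_minus_commute)
  show "lp_norm p (\<lambda>_. 0) = 0" by (simp add: lp_norm_def)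
qed (use assms lp_minkowski lp_norm_eq_0 lp_norm_nonneg in auto)

lemma shift_poly_c0: "x \<in> c0_space \<Longrightarrow> shift_poly x \<in> c0_space"
  unfolding c0_space_def shift_poly_def backward_shift_def
  by (auto intro!: tendsto_mult_right_zero LIMSEQ_Suc)

lemma shift_poly_lp: "x \<in> lp_space p \<Longrightarrow> shift_poly x \<in> lp_space p"
  unfolding lp_space_def shift_poly_def backward_shift_def
  by (auto simp: norm_mult powr_mult summable_Suc_iff[of "\<lambda>i. cmod (x i) powr p"]
      intro!: summable_mult)

text \<open>\<open>shift_poly\<close> is the diagonal of the bilinear map \<open>(x, y) \<mapsto> x\<^sub>1 B y\<close>; its degree is 2.\<close>

lemma shift_poly_homogeneous: "shift_poly (\<lambda>i. c * x i) = (\<lambda>i. c ^ 2 * shift_poly x i)"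
  by (simp add: shift_poly_def backward_shift_def power2_eq_square mult_ac)

end

theory Submission
  imports Defs
begin

text \<open>
  The \<open>n\<close>-th iterate is \<open>P\<^sup>n x = c\<^sub>n(x) B\<^sup>n x\<close>, where the scalar \<open>c\<^sub>n(x)\<close> (\<open>iter_coeff\<close>) depends only on
  the first \<open>n\<close> coordinates of \<open>x\<close>.  Hence replacing the coordinates of \<open>x\<close> from \<open>m\<close> on by those of
  \<open>v / c\<^sub>m(x)\<close> gives a point that \<open>P\<^sup>m\<close> maps exactly to \<open>v\<close>, and this point is close to \<open>x\<close> when
  \<open>m\<close> and \<open>c\<^sub>m(x)\<close> are large.  The set attracted to 0 is open and dense, so the Julia set \<open>J\<close> is its
  complement and is invariant under preimages; if \<open>u \<in> J\<close> and \<open>l > 1\<close> then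
  \<open>c\<^sub>n(l u) \<longlonglongrightarrow> \<infinity>\<close> in modulus.  Therefore every neighbourhood of \<open>u\<close> in \<open>J\<close> contains a preimage of
  every point of \<open>J\<close>, and Baire's theorem yields a dense orbit; periodic points come from
  \<open>v = x\<close>.  Everything else reduces to perturbing a given vector to one whose coefficients
  \<open>c\<^sub>m\<close> are large: along a common kernel vector of finitely many functionals, by adding a fixed point
  whose norm is close to the limit radius, or by dividing by a small scalar.
\<close>

section \<open>Countable bases and topological transitivity\<close>

lemma (in Metric_space) second_countable_mtopology:
  assumes "countable D" "D \<subseteq> M" "\<And>x e. x \<in> M \<Longrightarrow> 0 < e \<Longrightarrow> \<exists>z\<in>D. d x z < e"
  shows "second_countable mtopology"
  unfolding second_countable_def
proof (intro exI conjI allI impI ballI)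
  let ?B = "(\<lambda>(z, n). mball z (1 / Suc n)) ` (D \<times> (UNIV :: nat set))"
  show "countable ?B"
    using assms(1) by auto
  show "openin mtopology V" if "V \<in> ?B" for V
    using that by auto
  fix U x
  assume U: "openin mtopology U \<and> x \<in> U"
  then have x: "x \<in> M"
    using openin_subset by fastforce
  obtain e where e: "e > 0" "mball x e \<subseteq> U"
    using U openin_mtopology by blast
  obtain n where n: "1 / Suc n < e / 2"
    using e nat_approx_posE half_gt_zero by metis
  obtain z where z: "z \<in> D" "d x z < 1 / Suc n"
    using assms(3)[OF x, of "1 / Suc n"] by auto
  have zM: "z \<in> M"
    using z assms(2) by auto
  have "mball z (1 / Suc n) \<subseteq> mball x e"
  proof
    fix y
    assume y: "y \<in> mball z (1 / Suc n)"
    then have "d x y \<le> d x z + d z y"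
      using x zM by (intro triangle) auto
    also have "\<dots> < e"
      using y z n by auto
    finally show "y \<in> mball x e"
      using x y by auto
  qed
  moreover have "x \<in> mball z (1 / Suc n)"
    using x zM z commute by (auto simp: in_mball)
  ultimately show "\<exists>V\<in>?B. x \<in> V \<and> V \<subseteq> U"
    using z(1) e(2) by (intro bexI[of _ "mball z (1 / Suc n)"]) auto
qed

text \<open>Birkhoff's transitivity argument: the points that some member of \<open>F\<close> sends
  into a given basic open set form an open dense set, and by Baire countably many such sets have a
  common point. A family \<open>F\<close> in place of the iterates of one map also covers scalar
  multiples of iterates, as supercyclicity needs.\<close>

lemma ex_dense_family_orbit:
  assumes compl: "completely_metrizable_space T" and sec: "second_countable T"
    and ne: "topspace T \<noteq> {}"
    and cont: "\<And>f. f \<in> F \<Longrightarrow> continuous_map T T f"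
    and trans: "\<And>U V. openin T U \<Longrightarrow> U \<noteq> {} \<Longrightarrow> openin T V \<Longrightarrow> V \<noteq> {} \<Longrightarrow>
                  \<exists>f\<in>F. f ` U \<inter> V \<noteq> {}"
  shows "\<exists>x\<in>topspace T. dense_in T ((\<lambda>f. f x) ` F)"
proof -
  obtain \<B> where \<B>: "countable \<B>" "\<And>V. V \<in> \<B> \<Longrightarrow> openin T V"
    "\<And>U x. openin T U \<Longrightarrow> x \<in> U \<Longrightarrow> \<exists>V\<in>\<B>. x \<in> V \<and> V \<subseteq> U"
    using sec unfolding second_countable_def by metis
  define W where "W V = {x \<in> topspace T. \<exists>f\<in>F. f x \<in> V}" for V
  have "T closure_of \<Inter>(W ` (\<B> - {{}})) = topspace T"
  proof (rule Baire_category)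
    show "countable (W ` (\<B> - {{}}))"
      using \<B>(1) by auto
    fix S
    assume "S \<in> W ` (\<B> - {{}})"
    then obtain V where V: "V \<in> \<B>" "V \<noteq> {}" and S: "S = W V"
      by auto
    have "S = (\<Union>f\<in>F. {x \<in> topspace T. f x \<in> V})"
      unfolding S W_def by auto
    then have "openin T S"
      using openin_continuous_map_preimage[OF cont \<B>(2)[OF V(1)]] by auto
    moreover have "T closure_of S = topspace T"
      unfolding dense_intersects_open
    proof (intro allI impI)
      fix U
      assume U: "openin T U \<and> U \<noteq> {}"
      then obtain f u where "f \<in> F" "u \<in> U" "f u \<in> V"
        using trans[of U V] \<B>(2)[OF V(1)] V(2) by auto
      then show "S \<inter> U \<noteq> {}"
        using U openin_subset[of T U] unfolding S W_def by auto
    qed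
    ultimately show "openin T S \<and> T closure_of S = topspace T"
      by simp
  qed (use compl in simp)
  \<comment> \<open>The intersection is dense in a nonempty space, hence nonempty.\<close>
  moreover have "T closure_of {} \<noteq> topspace T"
    using ne by (metis closure_of_empty)
  ultimately obtain x where x: "x \<in> topspace T" "x \<in> \<Inter>(W ` (\<B> - {{}}))"
    using ne closure_of_restrict[of T "\<Inter>(W ` (\<B> - {{}}))"]
    by (metis closure_of_empty equals0I IntE)
  have sub: "(\<lambda>f. f x) ` F \<subseteq> topspace T"
    using x(1) continuous_map_image_subset_topspace[OF cont] by auto
  have "T closure_of ((\<lambda>f. f x) ` F) = topspace T"
    unfolding dense_intersects_open
  proof (intro allI impI)
    fix U
    assume U: "openin T U \<and> U \<noteq> {}"
    then obtain V where V: "V \<in> \<B>" "V \<noteq> {}" "V \<subseteq> U"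
      using \<B>(3) by (metis all_not_in_conv)
    then have "x \<in> W V"
      using x(2) by auto
    then show "(\<lambda>f. f x) ` F \<inter> U \<noteq> {}"
      using V(3) unfolding W_def by auto
  qed
  then show ?thesis
    using x(1) sub unfolding dense_in_def by auto
qed

section \<open>Iterates of the shift polynomial\<close>

definition zero_below :: "nat \<Rightarrow> cseq \<Rightarrow> cseq" where
  "zero_below m x = (\<lambda>i. if i < m then 0 else x i)"

definition splice_at :: "nat \<Rightarrow> cseq \<Rightarrow> cseq \<Rightarrow> cseq" where
  "splice_at m x v = (\<lambda>i. if i < m then x i else v (i - m))"

text \<open>Fixed points of \<open>shift_poly\<close>: the leading coordinate \<open>a\<close> makes
  up for the ratio \<open>1 / a\<close>.\<close>

definition geom_seq :: "real \<Rightarrow> cseq" where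
  "geom_seq a = (\<lambda>i. complex_of_real (a * (1 / a) ^ i))"

text \<open>Dropping the first \<open>m > 0\<close> coordinates divides this sequence by
  \<open>c\<close>. Hence for \<open>c = iter_coeff m x \<noteq> 0\<close> it is fixed by the
  \<open>m\<close>-th iterate of \<open>shift_poly\<close>.\<close>

definition periodize :: "nat \<Rightarrow> complex \<Rightarrow> cseq \<Rightarrow> cseq" where
  "periodize m c x = (\<lambda>i. x (i mod m) / c ^ (i div m))"

lemma splice_at_periodize:
  assumes "0 < m"
  shows "splice_at m x (\<lambda>i. periodize m c x i / c) = periodize m c x"
proof
  fix i
  show "splice_at m x (\<lambda>i. periodize m c x i / c) i = periodize m c x i"
  proof (cases "i < m")
    case False
    then show ?thesis
      using assms le_div_geq[of m i] le_mod_geq[of m i] by (simp add: splice_at_def periodize_def)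
  qed (simp add: splice_at_def periodize_def)
qed

text \<open>The recursion comes from applying P to \<open>c B\<^sup>n x\<close>, where
  \<open>c = iter_coeff n x\<close>: the leading coordinate is \<open>c * x n\<close>, and it
  multiplies \<open>c B\<^sup>n\<^sup>+\<^sup>1 x\<close>.\<close>

fun iter_coeff :: "nat \<Rightarrow> cseq \<Rightarrow> complex" where
  "iter_coeff 0 x = 1"
| "iter_coeff (Suc n) x = iter_coeff n x ^ 2 * x n"

lemma shift_poly_eq: "shift_poly x = (\<lambda>i. x 0 * backward_shift x i)"
  by (simp add: shift_poly_def)

lemma funpow_shift_poly: "(shift_poly ^^ n) x = (\<lambda>i. iter_coeff n x * x (n + i))"
  by (induction n) (auto simp: shift_poly_def backward_shift_def power2_eq_square mult_ac)

lemma iter_coeff_cong: "(\<And>i. i < n \<Longrightarrow> x i = y i) \<Longrightarrow> iter_coeff n x = iter_coeff n y"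
  by (induction n) auto

lemma iter_coeff_eq_0_iff: "iter_coeff n x = 0 \<longleftrightarrow> (\<exists>i<n. x i = 0)"
  by (induction n) (auto simp: less_Suc_eq)

lemma iter_coeff_mono:
  "(\<And>i. i < n \<Longrightarrow> cmod (x i) \<le> cmod (y i)) \<Longrightarrow> cmod (iter_coeff n x) \<le> cmod (iter_coeff n y)"
  by (induction n) (auto simp: norm_mult norm_power intro!: mult_mono power_mono)

text \<open>The coefficient is homogeneous of degree \<open>2 ^ n - 1\<close>; the extra factor
  \<open>c\<close> on the left avoids the subtraction in the exponent.\<close>

lemma iter_coeff_scale: "c * iter_coeff n (\<lambda>i. c * x i) = c ^ (2 ^ n) * iter_coeff n x"
proof (induction n)
  case (Suc n)
  have "c * iter_coeff (Suc n) (\<lambda>i. c * x i) = (c * iter_coeff n (\<lambda>i. c * x i))\<^sup>2 * x n"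
    by (simp add: power2_eq_square)
  also have "\<dots> = (c ^ 2 ^ n)\<^sup>2 * iter_coeff (Suc n) x"
    unfolding Suc by (simp add: power_mult_distrib mult_ac)
  also have "(c ^ 2 ^ n)\<^sup>2 = c ^ 2 ^ Suc n"
    by (simp flip: power_mult add: mult.commute)
  finally show ?case .
qed simp

text \<open>Since \<open>geom_seq a\<close> is fixed, its coefficient must undo the factor
  \<open>(1 / a) ^ n\<close> that \<open>n\<close> shifts produce.\<close>

lemma iter_coeff_geom_seq: "a \<noteq> 0 \<Longrightarrow> iter_coeff n (geom_seq a) = complex_of_real (a ^ n)"
proof (induction n)
  case (Suc n)
  then have "iter_coeff (Suc n) (geom_seq a) = complex_of_real ((a ^ n)\<^sup>2 * (a * (1 / a) ^ n))"
    by (simp add: geom_seq_def)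
  also have "(a ^ n)\<^sup>2 * (a * (1 / a) ^ n) = a ^ Suc n"
    using Suc.prems by (simp add: power_divide power2_eq_square field_simps)
  finally show ?case .
qed simp

lemma iter_coeff_splice_at [simp]: "iter_coeff m (splice_at m x v) = iter_coeff m x"
  by (rule iter_coeff_cong) (simp add: splice_at_def)

lemma funpow_shift_poly_splice_at:
  "iter_coeff m x \<noteq> 0 \<Longrightarrow>
   (shift_poly ^^ m) (splice_at m x (\<lambda>i. v i / iter_coeff m x)) = v"
  unfolding funpow_shift_poly iter_coeff_splice_at by (simp add: splice_at_def)

text \<open>The coefficient is a product of powers of the first \<open>m\<close> coordinates. Along
  the line, a coordinate with \<open>h i = 0\<close> stays a nonzero constant and every other one
  grows linearly in modulus; the coordinate \<open>j\<close> guarantees at least one of the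
  latter.\<close>

lemma filterlim_iter_coeff_line:
  assumes "\<And>i. i < m \<Longrightarrow> y i \<noteq> 0" "j < m" "h j \<noteq> 0"
  shows "filterlim (\<lambda>t. cmod (iter_coeff m (\<lambda>i. y i + of_real t * h i))) at_top at_top"
  using assms
proof (induction m arbitrary: j)
  case (Suc m)
  let ?c = "\<lambda>t::real. iter_coeff m (\<lambda>i. y i + of_real t * h i)"
  let ?f = "\<lambda>t::real. y m + of_real t * h m"
  have f: "filterlim (\<lambda>t. cmod (?f t)) at_top at_top" if "h m \<noteq> 0"
  proof (rule filterlim_at_top_mono)
    show "filterlim (\<lambda>t. - cmod (y m) + t * cmod (h m)) at_top at_top"
      using that
      by (intro filterlim_tendsto_add_at_top[OF tendsto_const] filterlim_at_top_mult_tendsto_pos[OF tendsto_const]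
            filterlim_ident) auto
    have "- cmod (y m) + t * cmod (h m) \<le> cmod (?f t)" for t
      using norm_diff_ineq[of "of_real t * h m" "y m"]
        mult_right_mono[OF abs_ge_self[of t] norm_ge_zero[of "h m"]]
      by (simp add: norm_mult add.commute)
    then show "\<forall>\<^sub>F t in at_top. - cmod (y m) + t * cmod (h m) \<le> cmod (?f t)"
      by simp
  qed
  have eq: "(\<lambda>t. cmod (iter_coeff (Suc m) (\<lambda>i. y i + of_real t * h i))) = (\<lambda>t. (cmod (?c t))\<^sup>2 * cmod (?f t))"
    by (simp add: norm_mult norm_power)
  show ?case
  proof (cases "\<exists>j<m. h j \<noteq> 0")
    case True
    then have c: "filterlim (\<lambda>t. (cmod (?c t))\<^sup>2) at_top at_top"
      using Suc by (intro filterlim_pow_at_top) auto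
    show ?thesis
    proof (cases "h m = 0")
      case True
      then show ?thesis
        unfolding eq using Suc.prems(1) c by (auto intro!: filterlim_at_top_mult_tendsto_pos[OF tendsto_const])
    qed (unfold eq, rule filterlim_at_top_mult_at_top[OF c f])
  next
    case False
    then have c: "?c t = iter_coeff m y" for t
      by (intro iter_coeff_cong) auto
    have "h m \<noteq> 0"
      using False Suc.prems(2,3) less_Suc_eq by auto
    moreover have "iter_coeff m y \<noteq> 0"
      using Suc.prems(1) by (auto simp: iter_coeff_eq_0_iff)
    ultimately show ?thesis
      unfolding eq c by (intro filterlim_tendsto_pos_mult_at_top[OF tendsto_const _ f]) auto
  qed
qed simp

section \<open>Solid sequence spaces\<close>

text \<open>What the argument uses of c_0 and l_p. Solidity reduces membership and norm bounds to
  comparing moduli; \<open>N_zero_below\<close> makes finitely supported sequences dense, which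
  fails for bounded sequences; \<open>complete\<close> is for Baire's theorem; \<open>geom\<close>
  supplies fixed points and a vector without zero coordinates.\<close>

locale normed_seq_space =
  fixes X :: "cseq set" and N :: "cseq \<Rightarrow> real"
  assumes metric: "Metric_space X (norm_dist X N)"
    and add: "x \<in> X \<Longrightarrow> y \<in> X \<Longrightarrow> (\<lambda>i. x i + y i) \<in> X"
    and N_triangle: "x \<in> X \<Longrightarrow> y \<in> X \<Longrightarrow> N (\<lambda>i. x i + y i) \<le> N x + N y"
    and scale: "x \<in> X \<Longrightarrow> (\<lambda>i. c * x i) \<in> X"
    and N_scale: "x \<in> X \<Longrightarrow> N (\<lambda>i. c * x i) = cmod c * N x"
    and solid: "y \<in> X \<Longrightarrow> (\<And>i. cmod (x i) \<le> cmod (y i)) \<Longrightarrow> x \<in> X"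
    and N_solid: "y \<in> X \<Longrightarrow> (\<And>i. cmod (x i) \<le> cmod (y i)) \<Longrightarrow> N x \<le> N y"
    and coord: "x \<in> X \<Longrightarrow> cmod (x i) \<le> N x"
    and bshift: "x \<in> X \<Longrightarrow> backward_shift x \<in> X"
    and N_bshift: "x \<in> X \<Longrightarrow> N (backward_shift x) \<le> N x"
    and fshift: "x \<in> X \<Longrightarrow> splice_at 1 (\<lambda>_. 0) x \<in> X"
    and N_fshift: "x \<in> X \<Longrightarrow> N (splice_at 1 (\<lambda>_. 0) x) \<le> N x"
    and N_zero_below: "x \<in> X \<Longrightarrow> (\<lambda>m. N (zero_below m x)) \<longlonglongrightarrow> 0"
    and complete: "(\<And>n. s n \<in> X) \<Longrightarrow>
       (\<And>e. 0 < e \<Longrightarrow> \<exists>K. \<forall>m\<ge>K. \<forall>n\<ge>K. N (\<lambda>i. s m i - s n i) < e) \<Longrightarrow>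
       \<exists>x\<in>X. (\<lambda>n. N (\<lambda>i. s n i - x i)) \<longlonglongrightarrow> 0"
    and geom: "1 < a \<Longrightarrow> geom_seq a \<in> X"
begin

sublocale Metric_space X "norm_dist X N"
  by (rule metric)

abbreviation T :: "cseq topology" where
  "T \<equiv> norm_topology X N"

abbreviation A :: "cseq set" where
  "A \<equiv> attraction_set X N shift_poly"

abbreviation J :: "cseq set" where
  "J \<equiv> julia_set X N shift_poly"

section \<open>Density, completeness and separability of the space\<close>

lemma T_eq: "T = mtopology"
  by (simp add: norm_topology_def)

lemma topspace_T [simp]: "topspace T = X"
  by (simp add: T_eq)

lemma N_nonneg: "x \<in> X \<Longrightarrow> 0 \<le> N x"
  using coord[of x 0] norm_ge_zero order_trans by blast

lemma diff: "x \<in> X \<Longrightarrow> y \<in> X \<Longrightarrow> (\<lambda>i. x i - y i) \<in> X"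
  using add[of x "\<lambda>i. -1 * y i"] scale[of y "-1"] by simp

lemma N_diff: "x \<in> X \<Longrightarrow> y \<in> X \<Longrightarrow> N (\<lambda>i. x i - y i) \<le> N x + N y"
  using N_triangle[of x "\<lambda>i. -1 * y i"] scale[of y "-1"] N_scale[of y "-1"] by simp

lemma N_diff_commute: "x \<in> X \<Longrightarrow> y \<in> X \<Longrightarrow> N (\<lambda>i. x i - y i) = N (\<lambda>i. y i - x i)"
  using N_scale[of "\<lambda>i. x i - y i" "-1"] diff by simp

lemma N_diff_triangle:
  assumes "x \<in> X" "y \<in> X" "z \<in> X"
  shows "N (\<lambda>i. x i - z i) \<le> N (\<lambda>i. x i - y i) + N (\<lambda>i. y i - z i)"
  using N_triangle[OF diff[OF assms(1,2)] diff[OF assms(2,3)]] by simp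

lemma dist_eq: "x \<in> X \<Longrightarrow> y \<in> X \<Longrightarrow> norm_dist X N x y = N (\<lambda>i. x i - y i)"
  by (simp add: norm_dist_def)

lemma zero_mem: "(\<lambda>_. 0) \<in> X"
  using geom[of 2] solid[of _ "\<lambda>_. 0"] by auto

lemma N_zero: "N (\<lambda>_. 0) = 0"
  using N_scale[OF zero_mem, of 0] by simp

lemma dense_in_subtopology_iff:
  assumes "C \<subseteq> X"
  shows "dense_in (subtopology T C) S \<longleftrightarrow>
         S \<subseteq> C \<and> (\<forall>y\<in>C. \<forall>e>0. \<exists>z\<in>S. N (\<lambda>i. y i - z i) < e)"
proof (cases "S \<subseteq> C")
  case True
  then have "dense_in (subtopology T C) S \<longleftrightarrow> C \<subseteq> mtopology closure_of S"
    using assms by (auto simp: dense_in_def T_eq closure_of_subtopology Int_absorb1)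
  also have "\<dots> \<longleftrightarrow> (\<forall>y\<in>C. \<forall>e>0. \<exists>z\<in>S. N (\<lambda>i. y i - z i) < e)"
    using True assms unfolding metric_closure_of
    by (smt (verit, best) dist_eq in_mball mem_Collect_eq subset_iff)
  finally show ?thesis
    using True by simp
qed (use assms in \<open>auto simp: dense_in_def\<close>)

lemma dense_in_iff:
  "dense_in T S \<longleftrightarrow> S \<subseteq> X \<and> (\<forall>y\<in>X. \<forall>e>0. \<exists>z\<in>S. N (\<lambda>i. y i - z i) < e)"
  using dense_in_subtopology_iff[of X S] by (metis subtopology_topspace topspace_T order_refl)

lemma completely_metrizable_T: "completely_metrizable_space T"
  unfolding T_eq
proof (rule completely_metrizable_space_mtopology)
  show mcomplete
    unfolding mcomplete_def
  proof (intro allI impI)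
    fix s
    assume "MCauchy s"
    then have s: "s n \<in> X" and c: "\<And>e. 0 < e \<Longrightarrow> \<exists>K. \<forall>m n. K \<le> m \<longrightarrow> K \<le> n \<longrightarrow> norm_dist X N (s m) (s n) < e"
      for n
      unfolding MCauchy_def by auto
    have "\<exists>K. \<forall>m\<ge>K. \<forall>n\<ge>K. N (\<lambda>i. s m i - s n i) < e" if "0 < e" for e
      using c[OF that] s by (simp add: dist_eq)
    then obtain x where "x \<in> X" "(\<lambda>n. N (\<lambda>i. s n i - x i)) \<longlonglongrightarrow> 0"
      using complete[of s] s by blast
    then show "\<exists>x. limitin mtopology s x sequentially"
      using s by (intro exI[of _ x]) (auto simp: limitin_metric dist_eq order_tendsto_iff)
  qed
qed

text \<open>By solidity, a perturbation dominated coordinatewise by a multiple of one fixed vector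
  stays in the space and is small in norm. The absolute value appears because no sign is assumed for
  \<open>c\<close>.\<close>

lemma dominated_approx:
  assumes "w \<in> X" "y \<in> X" "\<And>i. cmod (x i - y i) \<le> c * cmod (w i)"
  shows "x \<in> X" "N (\<lambda>i. x i - y i) \<le> \<bar>c\<bar> * N w"
proof -
  have le: "cmod (x i - y i) \<le> cmod (complex_of_real c * w i)" for i
    using assms(3)[of i] by (smt (verit) norm_mult norm_of_real mult_right_mono norm_ge_zero)
  have w: "(\<lambda>i. complex_of_real c * w i) \<in> X"
    by (rule scale[OF assms(1)])
  then have "(\<lambda>i. x i - y i) \<in> X"
    using le by (rule solid)
  from add[OF this assms(2)] show "x \<in> X"
    by simp
  show "N (\<lambda>i. x i - y i) \<le> \<bar>c\<bar> * N w"
    using N_solid[OF w le] N_scale[OF assms(1)] by simp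
qed

lemma zero_below_mem: "x \<in> X \<Longrightarrow> zero_below m x \<in> X"
  by (rule solid[of x]) (auto simp: zero_below_def)

lemma ex_positive: obtains w where "w \<in> X" "\<And>i. w i \<noteq> 0"
  using geom[of 2] by (intro that[of "geom_seq 2"]) (auto simp: geom_seq_def)

text \<open>Finitely supported sequences with entries in a countable dense subset of the complex
  numbers approximate every truncation.\<close>

lemma separable_T: "\<exists>D. countable D \<and> D \<subseteq> X \<and> (\<forall>x\<in>X. \<forall>e>0. \<exists>z\<in>D. norm_dist X N x z < e)"
proof -
  obtain Q :: "complex set" where Q: "countable Q" "\<And>U. open U \<Longrightarrow> U \<noteq> {} \<Longrightarrow> \<exists>q\<in>Q. q \<in> U"
    using countable_dense_setE by blast
  obtain w where w: "w \<in> X" "\<And>i. w i \<noteq> 0"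
    using ex_positive by blast
  define fs where "fs l = (\<lambda>i. if i < length l then l ! i else (0::complex))" for l
  have fs: "fs l \<in> X" for l
  proof (rule solid)
    \<comment> \<open>The sum bounds each of the finitely many ratios, so \<open>c * w\<close>
      dominates the finite sequence.\<close>
    define c where "c = (\<Sum>j<length l. cmod (l ! j / w j))"
    show "(\<lambda>i. complex_of_real c * w i) \<in> X"
      by (rule scale[OF w(1)])
    show "cmod (fs l i) \<le> cmod (complex_of_real c * w i)" for i
    proof (cases "i < length l")
      case True
      have "cmod (l ! i / w i) \<le> c"
        unfolding c_def by (rule member_le_sum[of i "{..<length l}" "\<lambda>i. cmod (l ! i / w i)"]) (use True in auto)
      then have "cmod (l ! i) \<le> c * cmod (w i)"
        using w(2) by (simp add: norm_divide divide_simps)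
      then show ?thesis
        using True by (simp add: fs_def norm_mult)
          (meson abs_ge_self mult_right_mono norm_ge_zero order_trans)
    qed (simp add: fs_def)
  qed
  show ?thesis
  proof (intro exI[of _ "fs ` lists Q"] conjI ballI allI impI)
    show "countable (fs ` lists Q)"
      using Q(1) by simp
    show "fs ` lists Q \<subseteq> X"
      using fs by auto
    fix x and e :: real
    assume x: "x \<in> X" and e: "0 < e"
    have "\<forall>\<^sub>F m in sequentially. N (zero_below m x) < e / 2"
      using N_zero_below[OF x] e by (intro order_tendstoD) auto
    then obtain m where m: "N (zero_below m x) < e / 2"
      by (auto simp: eventually_sequentially)
    define \<delta> where "\<delta> = e / 2 / (N w + 1)"
    have Nw: "0 \<le> N w"
      by (rule N_nonneg[OF w(1)])
    have \<delta>: "0 < \<delta>" "\<delta> * N w < e / 2"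
      using e Nw unfolding \<delta>_def by (auto simp: field_simps)
    \<comment> \<open>The tolerance in coordinate \<open>i\<close> is proportional to
      \<open>w i\<close>, so that the total error is at most \<open>\<delta> * N w\<close> whatever
      the norm is.\<close>
    have "\<exists>q\<in>Q. q \<in> ball (x i) (\<delta> * cmod (w i))" for i
      using Q(2)[of "ball (x i) (\<delta> * cmod (w i))"] \<delta>(1) w(2)
      by (simp add: not_le)
    then obtain q where q: "\<And>i. q i \<in> Q" "\<And>i. dist (x i) (q i) < \<delta> * cmod (w i)"
      by (metis mem_ball)
    define z where "z = fs (map q [0..<m])"
    define x' where "x' = (\<lambda>i. x i - zero_below m x i)"
    have x': "x' \<in> X"
      unfolding x'_def by (rule diff[OF x zero_below_mem[OF x]])
    have "cmod (x' i - z i) \<le> \<delta> * cmod (w i)" for i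
      using q(2)[of i] \<delta>(1) by (auto simp: x'_def z_def fs_def zero_below_def dist_norm intro: less_imp_le)
    then have "N (\<lambda>i. x' i - z i) \<le> \<bar>\<delta>\<bar> * N w"
      using dominated_approx(2)[OF w(1), of z x' \<delta>] fs z_def by auto
    moreover have "N (\<lambda>i. x i - z i) \<le> N (\<lambda>i. x i - x' i) + N (\<lambda>i. x' i - z i)"
      using N_diff_triangle[OF x x', of z] fs z_def by auto
    moreover have "N (\<lambda>i. x i - x' i) = N (zero_below m x)"
      by (simp add: x'_def)
    ultimately have "norm_dist X N x z < e"
      using \<delta> m x fs[of "map q [0..<m]"] by (simp add: dist_eq z_def)
    moreover have "z \<in> fs ` lists Q"
      using q(1) unfolding z_def by (intro imageI) auto
    ultimately show "\<exists>z\<in>fs ` lists Q. norm_dist X N x z < e"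
      by blast
  qed
qed

lemma second_countable_T: "second_countable T"
  using separable_T second_countable_mtopology unfolding T_eq by meson

lemma continuous_map_TI:
  assumes "\<And>x. x \<in> X \<Longrightarrow> f x \<in> X"
    and "\<And>x e. x \<in> X \<Longrightarrow> 0 < e \<Longrightarrow>
           \<exists>\<delta>>0. \<forall>y\<in>X. N (\<lambda>i. x i - y i) < \<delta> \<longrightarrow> N (\<lambda>i. f x i - f y i) < e"
  shows "continuous_map T T f"
  unfolding T_eq metric_continuous_map[OF metric]
proof (intro conjI ballI allI impI)
  fix x and e :: real
  assume "x \<in> X" "0 < e"
  then obtain \<delta> where "\<delta> > 0" "\<And>y. y \<in> X \<Longrightarrow> N (\<lambda>i. x i - y i) < \<delta> \<Longrightarrow> N (\<lambda>i. f x i - f y i) < e"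
    using assms(2) by blast
  then show "\<exists>\<delta>>0. \<forall>y. y \<in> X \<and> norm_dist X N x y < \<delta> \<longrightarrow> norm_dist X N (f x) (f y) < e"
    using \<open>x \<in> X\<close> assms(1) by (intro exI[of _ \<delta>]) (auto simp: dist_eq)
qed (use assms(1) in auto)

lemma continuous_map_scale: "continuous_map T T (\<lambda>x i. c * x i)"
proof (rule continuous_map_TI)
  fix x and e :: real
  assume x: "x \<in> X" and e: "0 < e"
  show "\<exists>\<delta>>0. \<forall>y\<in>X. N (\<lambda>i. x i - y i) < \<delta> \<longrightarrow> N (\<lambda>i. c * x i - c * y i) < e"
  proof (intro exI[of _ "e / (cmod c + 1)"] conjI ballI impI)
    show "0 < e / (cmod c + 1)"
      using e by (simp add: add_nonneg_pos)
    fix y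
    assume y: "y \<in> X" and *: "N (\<lambda>i. x i - y i) < e / (cmod c + 1)"
    have "N (\<lambda>i. c * x i - c * y i) = cmod c * N (\<lambda>i. x i - y i)"
      using N_scale[OF diff[OF x y], of c] by (simp add: right_diff_distrib)
    also have "\<dots> \<le> (cmod c + 1) * N (\<lambda>i. x i - y i)"
      using N_nonneg[OF diff[OF x y]] by (intro mult_right_mono) auto
    also have "\<dots> < e"
      using * norm_ge_zero[of c] by (simp add: pos_less_divide_eq mult.commute add_nonneg_pos)
    finally show "N (\<lambda>i. c * x i - c * y i) < e" .
  qed
qed (rule scale)

section \<open>Norm estimates and continuity of the polynomial\<close>

lemma shift_poly_mem: "x \<in> X \<Longrightarrow> shift_poly x \<in> X"
  unfolding shift_poly_eq by (intro scale bshift)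

lemma funpow_mem: "x \<in> X \<Longrightarrow> (shift_poly ^^ n) x \<in> X"
  by (induction n) (auto intro: shift_poly_mem)

lemma N_shift_poly: "x \<in> X \<Longrightarrow> N (shift_poly x) \<le> (N x)\<^sup>2"
  unfolding shift_poly_eq using N_scale[OF bshift, of x "x 0"] coord[of x 0] N_bshift[of x] N_nonneg
  by (simp add: power2_eq_square mult_mono bshift)

text \<open>Bilinear splitting: P x - P y is the leading coordinate of x - y times B x, plus the
  leading coordinate of y times B (x - y).\<close>

lemma N_shift_poly_diff:
  assumes x: "x \<in> X" and y: "y \<in> X"
  shows "N (\<lambda>i. shift_poly x i - shift_poly y i) \<le> (N x + N y) * N (\<lambda>i. x i - y i)"
proof -
  let ?d = "\<lambda>i. x i - y i"
  have d: "?d \<in> X"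
    by (rule diff[OF x y])
  let ?u = "\<lambda>i. ?d 0 * backward_shift x i" and ?v = "\<lambda>i. y 0 * backward_shift ?d i"
  have "(\<lambda>i. shift_poly x i - shift_poly y i) = (\<lambda>i. ?u i + ?v i)"
    by (simp add: fun_eq_iff shift_poly_eq backward_shift_def algebra_simps)
  moreover have "?u \<in> X" "?v \<in> X"
    by (intro scale bshift x d)+
  ultimately have "N (\<lambda>i. shift_poly x i - shift_poly y i) \<le> N ?u + N ?v"
    using N_triangle by simp
  also have "N ?u \<le> N ?d * N x"
    using N_scale[OF bshift[OF x]] coord[OF d, of 0] N_bshift[OF x] N_nonneg[OF bshift[OF x]] N_nonneg[OF d]
    by (simp add: mult_mono)
  also have "N ?v \<le> N y * N ?d"
    using N_scale[OF bshift[OF d]] coord[OF y, of 0] N_bshift[OF d] N_nonneg[OF bshift[OF d]] N_nonneg[OF y]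
    by (simp add: mult_mono)
  finally show ?thesis
    by (simp add: algebra_simps)
qed

lemma continuous_map_shift_poly: "continuous_map T T shift_poly"
proof (rule continuous_map_TI)
  fix x and e :: real
  assume x: "x \<in> X" and e: "0 < e"
  have Nx: "0 \<le> N x"
    by (rule N_nonneg[OF x])
  let ?b = "2 * N x + 1"
  show "\<exists>\<delta>>0. \<forall>y\<in>X. N (\<lambda>i. x i - y i) < \<delta> \<longrightarrow> N (\<lambda>i. shift_poly x i - shift_poly y i) < e"
  proof (intro exI[of _ "min 1 (e / ?b)"] conjI ballI impI)
    show "0 < min 1 (e / ?b)"
      using e Nx by simp
    fix y
    assume y: "y \<in> X" and *: "N (\<lambda>i. x i - y i) < min 1 (e / ?b)"
    have "N y \<le> N x + 1"
      using N_diff[OF x diff[OF x y]] * by simp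
    then have "(N x + N y) * N (\<lambda>i. x i - y i) \<le> ?b * N (\<lambda>i. x i - y i)"
      using N_nonneg[OF diff[OF x y]] by (intro mult_right_mono) auto
    also have "\<dots> < e"
      using * Nx by (simp add: pos_less_divide_eq mult.commute)
    finally show "N (\<lambda>i. shift_poly x i - shift_poly y i) < e"
      using N_shift_poly_diff[OF x y] by simp
  qed
qed (rule shift_poly_mem)

lemma continuous_map_funpow: "continuous_map T T (shift_poly ^^ n)"
proof (induction n)
  case 0
  then show ?case
    using continuous_map_id by (simp add: id_def)
next
  case (Suc n)
  then show ?case
    using continuous_map_compose[OF _ continuous_map_shift_poly] by (simp add: o_def)
qed

section \<open>The Julia set\<close>

lemma N_funpow_le: "x \<in> X \<Longrightarrow> N ((shift_poly ^^ n) x) \<le> N x ^ (2 ^ n)"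
proof (induction n)
  case (Suc n)
  have "N ((shift_poly ^^ Suc n) x) \<le> (N ((shift_poly ^^ n) x))\<^sup>2"
    using N_shift_poly[OF funpow_mem[OF Suc.prems]] by simp
  also have "\<dots> \<le> (N x ^ 2 ^ n)\<^sup>2"
    using Suc N_nonneg funpow_mem by (intro power_mono) auto
  also have "\<dots> = N x ^ 2 ^ Suc n"
    by (simp flip: power_mult add: mult.commute)
  finally show ?case .
qed simp

text \<open>P at most squares the norm, so from the first iterate of norm below 1 the norms decay
  like powers with exponent \<open>2 ^ k\<close>.\<close>

lemma N_funpow_tendsto_0:
  assumes x: "x \<in> X" and n: "N ((shift_poly ^^ n) x) < 1"
  shows "(\<lambda>k. N ((shift_poly ^^ k) x)) \<longlonglongrightarrow> 0"
proof (rule LIMSEQ_offset[of _ n])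
  let ?y = "(shift_poly ^^ n) x"
  have y: "?y \<in> X" "0 \<le> N ?y"
    using funpow_mem[OF x] N_nonneg by auto
  have "N ((shift_poly ^^ (k + n)) x) \<le> N ?y ^ k" for k
  proof -
    have "N ((shift_poly ^^ (k + n)) x) \<le> N ?y ^ (2 ^ k)"
      using N_funpow_le[OF y(1), of k] by (simp add: funpow_add)
    also have "\<dots> \<le> N ?y ^ k"
      using y(2) n by (intro power_decreasing) (auto intro: less_imp_le)
    finally show ?thesis .
  qed
  then show "(\<lambda>k. N ((shift_poly ^^ (k + n)) x)) \<longlonglongrightarrow> 0"
    using y(2) n N_nonneg[OF funpow_mem[OF x]]
    by (intro tendsto_sandwich[OF _ _ tendsto_const LIMSEQ_realpow_zero[OF y(2) n]] always_eventually) auto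
qed

text \<open>Replaces the limit by a condition on a single iterate, from which openness follows by
  continuity.\<close>

lemma attraction_set_eq: "A = {x \<in> X. \<exists>n. N ((shift_poly ^^ n) x) < 1}"
proof -
  have "limitin T (\<lambda>n. (shift_poly ^^ n) x) (\<lambda>_. 0) sequentially \<longleftrightarrow>
        (\<lambda>n. N ((shift_poly ^^ n) x)) \<longlonglongrightarrow> 0" if "x \<in> X" for x
    using funpow_mem[OF that] zero_mem N_nonneg[OF funpow_mem[OF that]]
    by (auto simp: T_eq limitin_metric dist_eq tendsto_iff)
  moreover have "\<exists>n. N ((shift_poly ^^ n) x) < 1" if "(\<lambda>n. N ((shift_poly ^^ n) x)) \<longlonglongrightarrow> 0" for x
    using order_tendstoD(2)[OF that, of 1] by (auto simp: eventually_sequentially)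
  ultimately show ?thesis
    using N_funpow_tendsto_0 unfolding attraction_set_def by blast
qed

lemma openin_attraction_set: "openin T A"
proof -
  have "openin T {x \<in> X. (shift_poly ^^ n) x \<in> mball (\<lambda>_. 0) 1}" for n
    using openin_continuous_map_preimage[OF continuous_map_funpow openin_mball[folded T_eq]] by simp
  then have "openin T (\<Union>n. {x \<in> X. (shift_poly ^^ n) x \<in> mball (\<lambda>_. 0) 1})"
    by blast
  also have "(\<Union>n. {x \<in> X. (shift_poly ^^ n) x \<in> mball (\<lambda>_. 0) 1}) = A"
    using zero_mem funpow_mem N_diff_commute[OF zero_mem funpow_mem]
    by (auto simp: attraction_set_eq in_mball dist_eq)
  finally show ?thesis .
qed

lemma attraction_set_dense: "T closure_of A = X"
proof -
  have "dense_in T A"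
    unfolding dense_in_iff
  proof (intro conjI ballI allI impI)
    show "A \<subseteq> X"
      by (auto simp: attraction_set_eq)
    fix y and e :: real
    assume y: "y \<in> X" and e: "0 < e"
    obtain m where m: "N (zero_below m y) < e"
      using order_tendstoD(2)[OF N_zero_below[OF y] e] by (auto simp: eventually_sequentially)
    define z where "z = (\<lambda>i. y i - zero_below m y i)"
    \<comment> \<open>The coordinates of \<open>z\<close> vanish from index \<open>m\<close> on, and
      \<open>Suc m\<close> is the first iterate whose coefficient involves coordinate
      \<open>m\<close>. So the truncation \<open>z\<close> is mapped exactly to 0.\<close>
    have "iter_coeff (Suc m) z = 0"
      unfolding iter_coeff_eq_0_iff z_def zero_below_def by auto
    then have "(shift_poly ^^ Suc m) z = (\<lambda>_. 0)"
      by (simp only: funpow_shift_poly mult_zero_left)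
    then have "N ((shift_poly ^^ Suc m) z) < 1"
      using N_zero by simp
    moreover have "z \<in> X"
      unfolding z_def by (rule diff[OF y zero_below_mem[OF y]])
    ultimately have "z \<in> A"
      unfolding attraction_set_eq by blast
    moreover have "N (\<lambda>i. y i - z i) < e"
      using m by (simp add: z_def)
    ultimately show "\<exists>z\<in>A. N (\<lambda>i. y i - z i) < e"
      by blast
  qed
  then show ?thesis
    by (simp add: dense_in_def)
qed

lemma julia_set_eq: "J = {x \<in> X. \<forall>n. 1 \<le> N ((shift_poly ^^ n) x)}"
  unfolding julia_set_def frontier_of_def attraction_set_dense
    interior_of_openin[OF openin_attraction_set]
  unfolding attraction_set_eq not_le[symmetric] by blast

lemma julia_set_subset: "J \<subseteq> X"
  by (auto simp: julia_set_eq)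

text \<open>Being attracted to 0 depends only on the tail of the orbit, which \<open>x\<close>
  shares with its iterates.\<close>

lemma funpow_mem_julia_set_iff:
  assumes x: "x \<in> X"
  shows "(shift_poly ^^ m) x \<in> J \<longleftrightarrow> x \<in> J"
proof
  assume m: "(shift_poly ^^ m) x \<in> J"
  show "x \<in> J"
  proof (rule ccontr)
    assume "x \<notin> J"
    then obtain n where "N ((shift_poly ^^ n) x) < 1"
      using x by (auto simp: julia_set_eq not_le)
    from LIMSEQ_ignore_initial_segment[OF N_funpow_tendsto_0[OF x this], of m]
    have "\<forall>\<^sub>F k in sequentially. N ((shift_poly ^^ (k + m)) x) < 1"
      by (rule order_tendstoD) simp
    then obtain k where "N ((shift_poly ^^ k) ((shift_poly ^^ m) x)) < 1"
      by (auto simp: funpow_add eventually_sequentially)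
    then show False
      using m by (auto simp: julia_set_eq simp flip: not_le)
  qed
next
  assume "x \<in> J"
  moreover have "(shift_poly ^^ n) ((shift_poly ^^ m) x) = (shift_poly ^^ (n + m)) x" for n
    by (simp add: funpow_add)
  ultimately show "(shift_poly ^^ m) x \<in> J"
    using funpow_mem by (auto simp: julia_set_eq)
qed

text \<open>Outside J the orbit would tend to 0, but along the multiples of the period it is
  constantly \<open>x\<close>, which is nonzero.\<close>

lemma periodic_mem_julia_set:
  assumes x: "x \<in> X" "x i \<noteq> 0" and n: "0 < n" "(shift_poly ^^ n) x = x"
  shows "x \<in> J"
proof (rule ccontr)
  assume "x \<notin> J"
  then obtain k where "N ((shift_poly ^^ k) x) < 1"
    using x by (auto simp: julia_set_eq not_le)
  then have lim: "(\<lambda>k. N ((shift_poly ^^ k) x)) \<longlonglongrightarrow> 0"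
    by (rule N_funpow_tendsto_0[OF x(1)])
  have "strict_mono (\<lambda>j. n * j)"
    using n(1) by (auto simp: strict_mono_def)
  from LIMSEQ_subseq_LIMSEQ[OF lim this] have "(\<lambda>j. N ((shift_poly ^^ (n * j)) x)) \<longlonglongrightarrow> 0"
    by (simp add: o_def)
  moreover have "(shift_poly ^^ (n * j)) x = x" for j
    using n(2) by (induction j) (auto simp: funpow_add)
  ultimately have "N x = 0"
    using LIMSEQ_unique tendsto_const by fastforce
  then show False
    using coord[OF x(1), of i] x(2) by simp
qed

lemma geom_seq_mem_julia_set: "1 < a \<Longrightarrow> geom_seq a \<in> J"
proof (rule periodic_mem_julia_set[of _ 0 1])
  assume "1 < a"
  then show "(shift_poly ^^ 1) (geom_seq a) = geom_seq a"
    by (simp add: fun_eq_iff shift_poly_def backward_shift_def geom_seq_def)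
qed (auto simp: geom, simp add: geom_seq_def)

section \<open>Splicing tails: membership and error estimates\<close>

lemma shift_mem: "x \<in> X \<Longrightarrow> (\<lambda>i. x (n + i)) \<in> X"
  and N_shift: "x \<in> X \<Longrightarrow> N (\<lambda>i. x (n + i)) \<le> N x"
proof (induction n)
  case (Suc n)
  have eq: "(\<lambda>i. x (Suc n + i)) = backward_shift (\<lambda>i. x (n + i))"
    by (simp add: backward_shift_def)
  {
    case 1
    then show ?case
      unfolding eq using Suc by (intro bshift) auto
  next
    case 2
    then show ?case
      unfolding eq using Suc N_bshift order_trans by blast
  }
qed simp_all

lemma splice_at_zero_mem: "v \<in> X \<Longrightarrow> splice_at m (\<lambda>_. 0) v \<in> X"
  and N_splice_at_zero: "v \<in> X \<Longrightarrow> N (splice_at m (\<lambda>_. 0) v) \<le> N v"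
proof (induction m)
  case 0
  have "splice_at 0 (\<lambda>_. 0) v = v"
    by (simp add: splice_at_def)
  then show "v \<in> X \<Longrightarrow> splice_at 0 (\<lambda>_. 0) v \<in> X" "v \<in> X \<Longrightarrow> N (splice_at 0 (\<lambda>_. 0) v) \<le> N v"
    by simp_all
next
  case (Suc m)
  have eq: "splice_at (Suc m) (\<lambda>_. 0) v = splice_at 1 (\<lambda>_. 0) (splice_at m (\<lambda>_. 0) v)"
    by (auto simp: splice_at_def fun_eq_iff)
  {
    case 1
    then show ?case
      unfolding eq using Suc by (intro fshift) auto
  next
    case 2
    then show ?case
      unfolding eq using Suc N_fshift order_trans by blast
  }
qed

lemma splice_at_mem:
  assumes "x \<in> X" "v \<in> X"
  shows "splice_at m x v \<in> X"
proof -
  have "splice_at m x v = (\<lambda>i. (x i - zero_below m x i) + splice_at m (\<lambda>_. 0) v i)"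
    by (auto simp: splice_at_def zero_below_def)
  then show ?thesis
    using add[OF diff[OF assms(1) zero_below_mem[OF assms(1)]] splice_at_zero_mem[OF assms(2)]] by simp
qed

text \<open>The two sequences agree below \<open>m\<close>; what remains is the discarded tail of
  \<open>x\<close> and the copy of \<open>v\<close> moved to the right, which does not increase the
  norm.\<close>

lemma N_diff_splice_at:
  assumes "x \<in> X" "v \<in> X"
  shows "N (\<lambda>i. x i - splice_at m x v i) \<le> N (zero_below m x) + N v"
proof -
  have "(\<lambda>i. x i - splice_at m x v i) = (\<lambda>i. zero_below m x i - splice_at m (\<lambda>_. 0) v i)"
    by (auto simp: splice_at_def zero_below_def)
  then have "N (\<lambda>i. x i - splice_at m x v i) \<le> N (zero_below m x) + N (splice_at m (\<lambda>_. 0) v)"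
    using N_diff[OF zero_below_mem[OF assms(1)] splice_at_zero_mem[OF assms(2)]] by simp
  also have "\<dots> \<le> N (zero_below m x) + N v"
    using N_splice_at_zero[OF assms(2)] by simp
  finally show ?thesis .
qed

lemma divide_mem: "x \<in> X \<Longrightarrow> (\<lambda>i. x i / c) \<in> X"
  and N_divide: "x \<in> X \<Longrightarrow> N (\<lambda>i. x i / c) = N x / cmod c"
  using scale[of x "inverse c"] N_scale[of x "inverse c"]
  by (auto simp: divide_inverse norm_inverse mult.commute)

lemma splice_at_divide_mem_julia_set:
  assumes "x \<in> X" "v \<in> J" "iter_coeff m x \<noteq> 0"
  shows "splice_at m x (\<lambda>i. v i / iter_coeff m x) \<in> J"
proof -
  have "splice_at m x (\<lambda>i. v i / iter_coeff m x) \<in> X"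
    using assms julia_set_subset by (intro splice_at_mem divide_mem) auto
  then show ?thesis
    using funpow_mem_julia_set_iff[of _ m] funpow_shift_poly_splice_at[OF assms(3)] assms(2) by metis
qed

text \<open>Take \<open>x = l u\<close> with \<open>l\<close> slightly above 1. No iterate of
  \<open>u\<close> has norm below 1 and shifting does not increase the norm, so the coefficients of
  \<open>u\<close> have modulus at least \<open>1 / N u\<close>. Homogeneity of degree
  \<open>2 ^ n - 1\<close> then makes those of \<open>x\<close> grow at least like
  \<open>l ^ n\<close>.\<close>

lemma julia_set_approx:
  assumes u: "u \<in> J" and e: "0 < e"
  shows "\<exists>x\<in>X. N (\<lambda>i. u i - x i) < e \<and>
           filterlim (\<lambda>n. cmod (iter_coeff n x)) at_top sequentially"
proof -
  have uX: "u \<in> X"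
    using u julia_set_subset by auto
  have Nu: "1 \<le> N u"
    using u unfolding julia_set_eq by (auto dest: spec[of _ 0])
  \<comment> \<open>Moving from \<open>u\<close> to \<open>(1 + \<delta>) u\<close> costs
    \<open>\<delta> * N u\<close>, that is \<open>e / 2\<close>.\<close>
  define \<delta> where "\<delta> = e / 2 / N u"
  have \<delta>: "0 < \<delta>" "\<delta> * N u < e"
    using e Nu by (auto simp: \<delta>_def)
  define l where "l = 1 + \<delta>"
  have l: "1 < l"
    using \<delta> by (simp add: l_def)
  define x where "x = (\<lambda>i. complex_of_real l * u i)"
  have "N (\<lambda>i. u i - x i) = N (\<lambda>i. complex_of_real (- \<delta>) * u i)"
    by (simp add: x_def l_def algebra_simps)
  also have "\<dots> < e"
    using N_scale[OF uX, of "complex_of_real (- \<delta>)"] \<delta> by (simp add: norm_minus_cancel)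
  finally have near: "N (\<lambda>i. u i - x i) < e" .
  have lower: "l ^ n / (l * N u) \<le> cmod (iter_coeff n x)" for n
  proof -
    have "1 \<le> N ((shift_poly ^^ n) u)"
      using u by (simp add: julia_set_eq)
    also have "\<dots> = cmod (iter_coeff n u) * N (\<lambda>i. u (n + i))"
      unfolding funpow_shift_poly by (rule N_scale[OF shift_mem[OF uX]])
    also have "\<dots> \<le> cmod (iter_coeff n u) * N u"
      by (intro mult_left_mono N_shift uX) auto
    finally have 1: "1 \<le> cmod (iter_coeff n u) * N u" .
    have "l ^ n \<le> l ^ (2 ^ n) * 1"
      using \<delta> unfolding l_def by (simp add: power_increasing)
    also have "\<dots> \<le> l ^ (2 ^ n) * (cmod (iter_coeff n u) * N u)"
      using \<delta> 1 unfolding l_def by (intro mult_left_mono) auto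
    also have "\<dots> = cmod (complex_of_real l * iter_coeff n x) * N u"
      unfolding x_def iter_coeff_scale using l by (simp add: norm_mult norm_power)
    finally have "l ^ n \<le> cmod (iter_coeff n x) * (l * N u)"
      using l by (simp add: norm_mult mult_ac)
    then show ?thesis
      using Nu \<delta> by (subst pos_divide_le_eq) (auto simp: l_def)
  qed
  have "filterlim (\<lambda>n. (1 / (l * N u)) * l ^ n) at_top sequentially"
    using l Nu filterlim_at_infinity_imp_filterlim_at_top[OF filterlim_realpow_sequentially_gt1[of l]]
    by (intro filterlim_tendsto_pos_mult_at_top[OF tendsto_const]) auto
  then have "filterlim (\<lambda>n. cmod (iter_coeff n x)) at_top sequentially"
    using lower by (elim filterlim_at_top_mono) (auto intro: always_eventually)
  moreover have "x \<in> X"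
    unfolding x_def by (rule scale[OF uX])
  ultimately show ?thesis
    using near by blast
qed

lemma eventually_near_splice_at:
  assumes x: "x \<in> X" and v: "v \<in> X" and e: "0 < e"
    and lim: "filterlim (\<lambda>n. cmod (iter_coeff n x)) at_top sequentially"
  shows "\<forall>\<^sub>F m in sequentially. iter_coeff m x \<noteq> 0 \<and>
           N (\<lambda>i. x i - splice_at m x (\<lambda>i. v i / iter_coeff m x) i) < e"
proof -
  have "(\<lambda>m. N v / cmod (iter_coeff m x)) \<longlonglongrightarrow> 0"
    by (rule tendsto_divide_0[OF tendsto_const filterlim_at_top_imp_at_infinity[OF lim]])
  from tendsto_add[OF N_zero_below[OF x] this]
  have "\<forall>\<^sub>F m in sequentially. N (zero_below m x) + N v / cmod (iter_coeff m x) < e"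
    using e by (intro order_tendstoD) auto
  moreover have "\<forall>\<^sub>F m in sequentially. 0 < cmod (iter_coeff m x)"
    using lim[unfolded filterlim_at_top_dense] by blast
  ultimately show ?thesis
  proof eventually_elim
    case (elim m)
    then show ?case
      using N_diff_splice_at[OF x divide_mem[OF v], of m "iter_coeff m x"] N_divide[OF v] by auto
  qed
qed

text \<open>Move from \<open>u\<close> to a point with diverging coefficients, then splice in the
  tail that is sent to \<open>v\<close>. This gives the transitivity that Baire's theorem
  needs.\<close>

lemma julia_set_locally_onto:
  assumes u: "u \<in> J" and v: "v \<in> J" and e: "0 < e"
  shows "\<exists>x\<in>J. \<exists>m. N (\<lambda>i. u i - x i) < e \<and> (shift_poly ^^ m) x = v"
proof -
  have uX: "u \<in> X" and vX: "v \<in> X"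
    using u v julia_set_subset by auto
  obtain y where y: "y \<in> X" "N (\<lambda>i. u i - y i) < e / 2"
    "filterlim (\<lambda>n. cmod (iter_coeff n y)) at_top sequentially"
    using julia_set_approx[OF u, of "e / 2"] e by auto
  obtain m where m: "iter_coeff m y \<noteq> 0" "N (\<lambda>i. y i - splice_at m y (\<lambda>i. v i / iter_coeff m y) i) < e / 2"
    using eventually_near_splice_at[OF y(1) vX _ y(3), of "e / 2"] e by (auto simp: eventually_sequentially)
  let ?x = "splice_at m y (\<lambda>i. v i / iter_coeff m y)"
  have x: "?x \<in> J"
    by (rule splice_at_divide_mem_julia_set[OF y(1) v m(1)])
  then have "?x \<in> X"
    using julia_set_subset by auto
  then have "N (\<lambda>i. u i - ?x i) < e"
    using N_diff_triangle[OF uX y(1), of ?x] y(2) m(2) by simp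
  then show ?thesis
    using x funpow_shift_poly_splice_at[OF m(1)] by blast
qed

text \<open>Each block is smaller than the previous one by the factor \<open>cmod c\<close>. With
  \<open>a\<close> the \<open>m\<close>-th root of that factor, a multiple of
  \<open>geom_seq a\<close> dominates the sequence.\<close>

lemma periodize_mem:
  assumes x: "x \<in> X" and m: "0 < m" and c: "1 < cmod c"
  shows "periodize m c x \<in> X"
proof (rule solid)
  define a where "a = root m (cmod c)"
  have a: "1 < a" "a ^ m = cmod c"
    using m c real_root_gt_1_iff[of m "cmod c"] by (auto simp: a_def)
  \<comment> \<open>\<open>N x\<close> bounds the coordinates within a block; \<open>cmod c\<close>
    pays for rounding \<open>i\<close> down to a multiple of \<open>m\<close>, which loses less than
    one block.\<close>
  let ?K = "N x * cmod c"
  show "(\<lambda>i. complex_of_real ?K * geom_seq a i) \<in> X"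
    by (rule scale[OF geom[OF a(1)]])
  fix i
  have "cmod (periodize m c x i) \<le> N x / cmod c ^ (i div m)"
    using coord[OF x] c unfolding periodize_def norm_divide norm_power
    by (intro divide_right_mono) auto
  also have "cmod c ^ (i div m) = a ^ (m * (i div m))"
    by (simp add: power_mult a(2))
  also have "N x / a ^ (m * (i div m)) \<le> N x * (cmod c * (a * (1 / a) ^ i))"
  proof -
    have "a ^ i \<le> a ^ (m * (i div m) + m)"
      using a(1) m mod_less_divisor[OF m, of i] by (intro power_increasing) (use mult_div_mod_eq[of m i] in linarith)+
    also have "\<dots> = a ^ (m * (i div m)) * cmod c"
      by (simp add: power_add a(2))
    also have "\<dots> \<le> a * (a ^ (m * (i div m)) * cmod c)"
      using a(1) mult_right_mono[of 1 a "a ^ (m * (i div m)) * cmod c"] by simp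
    finally have "1 / a ^ (m * (i div m)) \<le> cmod c * (a * (1 / a) ^ i)"
      using a(1) by (simp add: power_one_over divide_simps mult_ac)
    from mult_left_mono[OF this N_nonneg[OF x]] show ?thesis
      by simp
  qed
  also have "\<dots> = cmod (complex_of_real ?K * geom_seq a i)"
    using N_nonneg[OF x] a(1) c by (simp add: geom_seq_def norm_mult norm_divide norm_power abs_mult)
  finally show "cmod (periodize m c x i) \<le> cmod (complex_of_real ?K * geom_seq a i)" .
qed

text \<open>The spliced tail is the periodic point itself divided by \<open>c\<close>, so its norm
  is not known in advance and has to be bounded through the same estimate.\<close>

lemma periodic_approx:
  assumes u: "u \<in> J" and e: "0 < e"
  shows "\<exists>x\<in>J. N (\<lambda>i. u i - x i) < e \<and> (\<exists>n>0. (shift_poly ^^ n) x = x)"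
proof -
  have uX: "u \<in> X"
    using u julia_set_subset by auto
  obtain y where y: "y \<in> X" "N (\<lambda>i. u i - y i) < e / 2"
    "filterlim (\<lambda>n. cmod (iter_coeff n y)) at_top sequentially"
    using julia_set_approx[OF u, of "e / 2"] e by auto
  \<comment> \<open>The factor 4 anticipates the bound \<open>N x \<le> 4 * N y\<close> derived
    below.\<close>
  have "(\<lambda>m. 4 * N y / cmod (iter_coeff m y)) \<longlonglongrightarrow> 0"
    by (rule tendsto_divide_0[OF tendsto_const filterlim_at_top_imp_at_infinity[OF y(3)]])
  from tendsto_add[OF N_zero_below[OF y(1)] this]
  have "\<forall>\<^sub>F m in sequentially. N (zero_below m y) + 4 * N y / cmod (iter_coeff m y) < e / 2"
    using e by (intro order_tendstoD) auto
  moreover have "\<forall>\<^sub>F m in sequentially. 2 < cmod (iter_coeff m y)"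
    using y(3)[unfolded filterlim_at_top_dense] by blast
  ultimately obtain m where m: "N (zero_below m y) + 4 * N y / cmod (iter_coeff m y) < e / 2"
    "2 < cmod (iter_coeff m y)" "0 < m"
    using eventually_gt_at_top[of 0]
    by (metis (mono_tags, lifting) eventually_conj_iff eventually_happens' sequentially_bot)
  define c where "c = iter_coeff m y"
  define x where "x = periodize m c y"
  have xX: "x \<in> X"
    unfolding x_def c_def using y(1) m by (intro periodize_mem) auto
  have x: "splice_at m y (\<lambda>i. x i / c) = x"
    unfolding x_def using splice_at_periodize[OF m(3)] .
  have per: "(shift_poly ^^ m) x = x"
    using funpow_shift_poly_splice_at[of m y x] x m(2) unfolding c_def by force
  have near: "N (\<lambda>i. y i - x i) \<le> N (zero_below m y) + N x / cmod c"
    using N_diff_splice_at[OF y(1) divide_mem[OF xX], of m c] N_divide[OF xX] x by simp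
  \<comment> \<open>Together these give \<open>N x \<le> 2 * N y + N x / 2\<close>; the requirement
    \<open>2 < cmod c\<close> serves to absorb the last term.\<close>
  have "N (zero_below m y) \<le> N y"
    by (rule N_solid[OF y(1)]) (simp add: zero_below_def)
  moreover have "N x \<le> N y + N (\<lambda>i. y i - x i)"
    using N_diff[OF y(1) diff[OF y(1) xX]] by simp
  moreover have "N x / cmod c \<le> N x / 2"
    using m(2) N_nonneg[OF xX] by (intro divide_left_mono) (auto simp: c_def)
  ultimately have "N x \<le> 4 * N y"
    using near by linarith
  then have "N x / cmod c \<le> 4 * N y / cmod c"
    by (intro divide_right_mono) auto
  then have "N (\<lambda>i. y i - x i) < e / 2"
    using near m(1) by (simp add: c_def)
  then have "N (\<lambda>i. u i - x i) < e"
    using N_diff_triangle[OF uX y(1) xX] y(2) by simp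
  moreover have "y 0 \<noteq> 0"
    using m(2,3) iter_coeff_eq_0_iff[of m y] by auto
  then have "x 0 \<noteq> 0"
    by (simp add: x_def periodize_def)
  then have "x \<in> J"
    by (rule periodic_mem_julia_set[OF xX _ m(3) per])
  ultimately show ?thesis
    using m(3) per by blast
qed

section \<open>Chaos on the Julia set\<close>

lemma openin_subtopologyD:
  assumes "C \<subseteq> X" "openin (subtopology T C) U" "u \<in> U"
  shows "\<exists>e>0. \<forall>x\<in>C. N (\<lambda>i. u i - x i) < e \<longrightarrow> x \<in> U"
proof -
  obtain V where V: "openin T V" "U = V \<inter> C"
    using assms(2) unfolding openin_subtopology by blast
  then obtain e where "e > 0" "mball u e \<subseteq> V"
    using assms(3) unfolding T_eq openin_mtopology by blast
  then show ?thesis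
    using V assms by (intro exI[of _ e]) (auto simp: in_mball dist_eq subset_iff)
qed

lemma closedin_julia_set: "closedin T J"
  unfolding julia_set_def by (rule closedin_frontier_of)

lemma continuous_map_julia_set: "continuous_map (subtopology T J) (subtopology T J) (shift_poly ^^ n)"
  unfolding continuous_map_in_subtopology
  using continuous_map_from_subtopology[OF continuous_map_funpow] julia_set_subset funpow_mem_julia_set_iff
  by (auto simp: subset_iff)

lemma chaotic_julia_set: "chaotic (subtopology T J) shift_poly"
  unfolding chaotic_def
proof (intro conjI)
  show "continuous_map (subtopology T J) (subtopology T J) shift_poly"
    using continuous_map_julia_set[of 1] by simp
  have top: "topspace (subtopology T J) = J"
    using julia_set_subset by auto
  have "\<exists>x\<in>topspace (subtopology T J). dense_in (subtopology T J) ((\<lambda>f. f x) ` range (\<lambda>n. shift_poly ^^ n))"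
  proof (rule ex_dense_family_orbit)
    show "completely_metrizable_space (subtopology T J)"
      by (rule completely_metrizable_space_closedin[OF completely_metrizable_T closedin_julia_set])
    show "second_countable (subtopology T J)"
      by (rule second_countable_subtopology[OF second_countable_T])
    show "topspace (subtopology T J) \<noteq> {}"
      using geom_seq_mem_julia_set[of 2] top by auto
    show "continuous_map (subtopology T J) (subtopology T J) f" if "f \<in> range (\<lambda>n. shift_poly ^^ n)" for f
      using that continuous_map_julia_set by auto
    fix U V
    assume U: "openin (subtopology T J) U" "U \<noteq> {}" and V: "openin (subtopology T J) V" "V \<noteq> {}"
    then obtain u v where uv: "u \<in> U" "v \<in> V"
      by auto
    then have "u \<in> J" "v \<in> J"
      using U V openin_subset top by blast+
    moreover obtain e where "e > 0" "\<And>x. x \<in> J \<Longrightarrow> N (\<lambda>i. u i - x i) < e \<Longrightarrow> x \<in> U"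
      using openin_subtopologyD[OF julia_set_subset U(1) uv(1)] by blast
    ultimately obtain x m where "x \<in> U" "(shift_poly ^^ m) x = v"
      using julia_set_locally_onto by blast
    then show "\<exists>f\<in>range (\<lambda>n. shift_poly ^^ n). f ` U \<inter> V \<noteq> {}"
      using uv(2) by blast
  qed
  moreover have "(\<lambda>f. f x) ` range (\<lambda>n. shift_poly ^^ n) = Orb shift_poly x" for x
    by (auto simp: Orb_def)
  ultimately show "\<exists>x\<in>topspace (subtopology T J). dense_in (subtopology T J) (Orb shift_poly x)"
    by simp
  show "dense_in (subtopology T J) (periodic_points (subtopology T J) shift_poly)"
    unfolding dense_in_subtopology_iff[OF julia_set_subset] periodic_points_def top
    using periodic_approx by blast
qed

text \<open>Without zero coordinates all coefficients \<open>iter_coeff m x\<close> are nonzero, so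
  a prescribed tail can be spliced in at every \<open>m\<close>.\<close>

lemma ex_nonzero_approx:
  assumes y: "y \<in> X" and e: "0 < e"
  shows "\<exists>x\<in>X. N (\<lambda>i. y i - x i) < e \<and> (\<forall>i. x i \<noteq> 0)"
proof -
  obtain w where w: "w \<in> X" "\<And>i. w i \<noteq> 0"
    using ex_positive by blast
  have Nw: "0 \<le> N w"
    by (rule N_nonneg[OF w(1)])
  define \<delta> where "\<delta> = e / (N w + 1)"
  have \<delta>: "0 < \<delta>" "\<delta> * N w < e"
    using e Nw by (auto simp: \<delta>_def field_simps)
  define x where "x = (\<lambda>i. if y i = 0 then of_real \<delta> * w i else y i)"
  have *: "cmod (x i - y i) \<le> \<delta> * cmod (w i)" for i
    using \<delta>(1) by (simp add: x_def norm_mult)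
  have "x \<in> X" "N (\<lambda>i. x i - y i) \<le> \<bar>\<delta>\<bar> * N w"
    using dominated_approx[OF w(1) y *] .
  then show ?thesis
    using \<delta> w(2) N_diff_commute[OF y, of x] by (intro bexI[of _ x]) (auto simp: x_def)
qed

section \<open>Weak density and supercyclicity\<close>

lemma continuous_functionalD:
  assumes "continuous_functional X N \<phi>" "x \<in> X" "y \<in> X"
  shows "\<phi> (\<lambda>i. a * x i + b * y i) = a * \<phi> x + b * \<phi> y"
  using assms by (simp add: continuous_functional_def)

lemma continuous_functional_zero:
  assumes "continuous_functional X N \<phi>"
  shows "\<phi> (\<lambda>_. 0) = 0"
  using continuous_functionalD[OF assms zero_mem zero_mem, of 0 0] by simp

lemma openin_weak_basis:
  assumes "continuous_functional X N \<phi>" "open U"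
  shows "openin T {x \<in> X. \<phi> x \<in> U}"
  using assms openin_continuous_map_preimage[of T euclidean \<phi> U]
  by (simp add: continuous_functional_def)

lemma topspace_weak: "topspace (weak_topology X N) = X"
proof -
  have "continuous_functional X N (\<lambda>_. 0)"
    by (simp add: continuous_functional_def)
  then have "X \<in> {{x \<in> X. \<phi> x \<in> U} | \<phi> U. continuous_functional X N \<phi> \<and> open U}"
    by (intro CollectI exI[of _ "\<lambda>_. 0"] exI[of _ UNIV]) auto
  then show ?thesis
    unfolding weak_topology_def topology_generated_by_topspace by blast
qed

lemma openin_weak_imp_openin:
  assumes "openin (weak_topology X N) W"
  shows "openin T W"
  using openin_topology_generated_by[OF assms[unfolded weak_topology_def]]
proof (induction rule: generate_topology_on.induct)
  case (Basis s)
  then show ?case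
    using openin_weak_basis by blast
qed auto

lemma openin_weakD:
  assumes "openin (weak_topology X N) W" "y \<in> W"
  shows "\<exists>F e. finite F \<and> (\<forall>\<phi>\<in>F. continuous_functional X N \<phi>) \<and> 0 < e \<and>
           (\<forall>z\<in>X. (\<forall>\<phi>\<in>F. cmod (\<phi> z - \<phi> y) < e) \<longrightarrow> z \<in> W)"
  using openin_topology_generated_by[OF assms(1)[unfolded weak_topology_def]] assms(2)
proof (induction rule: generate_topology_on.induct)
  case (Int a b)
  obtain F e where F: "finite F" "\<forall>\<phi>\<in>F. continuous_functional X N \<phi>" "0 < e"
    "\<forall>z\<in>X. (\<forall>\<phi>\<in>F. cmod (\<phi> z - \<phi> y) < e) \<longrightarrow> z \<in> a"
    using Int.IH(1) Int.prems by blast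
  obtain G d where G: "finite G" "\<forall>\<phi>\<in>G. continuous_functional X N \<phi>" "0 < d"
    "\<forall>z\<in>X. (\<forall>\<phi>\<in>G. cmod (\<phi> z - \<phi> y) < d) \<longrightarrow> z \<in> b"
    using Int.IH(2) Int.prems by blast
  show ?case
    using F G by (intro exI[of _ "F \<union> G"] exI[of _ "min e d"]) auto
next
  case (UN K)
  then obtain k where "k \<in> K" "y \<in> k"
    by blast
  then show ?case
    using UN.IH[of k] by (meson UnionI)
next
  case (Basis s)
  then obtain \<phi> U where s: "s = {x \<in> X. \<phi> x \<in> U}" "continuous_functional X N \<phi>" "open U"
    by blast
  then obtain e where "0 < e" "ball (\<phi> y) e \<subseteq> U"
    using Basis.prems open_contains_ball by blast
  then show ?case
    using s by (intro exI[of _ "{\<phi>}"] exI[of _ e]) (auto simp: dist_norm norm_minus_commute subset_iff)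
qed simp

text \<open>Continuity at 0, made uniform over finitely many functionals.\<close>

lemma continuous_functionals_small:
  assumes "finite F" "\<And>\<phi>. \<phi> \<in> F \<Longrightarrow> continuous_functional X N \<phi>" "0 < e"
  shows "\<exists>\<delta>>0. \<forall>\<phi>\<in>F. \<forall>x\<in>X. N x < \<delta> \<longrightarrow> cmod (\<phi> x) < e"
proof -
  have one: "\<exists>\<delta>>0. \<forall>x\<in>X. N x < \<delta> \<longrightarrow> cmod (\<phi> x) < e" if "\<phi> \<in> F" for \<phi>
  proof -
    have "openin (subtopology T X) {x \<in> X. \<phi> x \<in> ball 0 e}"
      using openin_weak_basis[OF assms(2)[OF that], of "ball 0 e"]
      by (metis open_ball subtopology_topspace topspace_T)
    moreover have "(\<lambda>_. 0) \<in> {x \<in> X. \<phi> x \<in> ball 0 e}"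
      using assms(3) zero_mem continuous_functional_zero[OF assms(2)[OF that]] by simp
    ultimately obtain \<delta> where "\<delta> > 0" "\<forall>x\<in>X. N (\<lambda>i. 0 - x i) < \<delta> \<longrightarrow> x \<in> {x \<in> X. \<phi> x \<in> ball 0 e}"
      using openin_subtopologyD[OF order_refl] by blast
    then show ?thesis
      using N_diff_commute[OF zero_mem] by (intro exI[of _ \<delta>]) auto
  qed
  have "\<forall>\<^sub>F \<delta> in at_right 0. \<forall>x\<in>X. N x < \<delta> \<longrightarrow> cmod (\<phi> x) < e" if f: "\<phi> \<in> F" for \<phi>
  proof -
    obtain d where "0 < d" "\<forall>x\<in>X. N x < d \<longrightarrow> cmod (\<phi> x) < e"
      using one[OF f] by blast
    then show ?thesis
      unfolding eventually_at_right_field by (intro exI[of _ d]) auto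
  qed
  then have "\<forall>\<^sub>F \<delta> in at_right 0. \<forall>\<phi>\<in>F. \<forall>x\<in>X. N x < \<delta> \<longrightarrow> cmod (\<phi> x) < e"
    using assms(1) by (intro eventually_ball_finite) blast+
  then obtain d where "0 < d" "\<And>\<delta>. 0 < \<delta> \<Longrightarrow> \<delta> < d \<Longrightarrow> \<forall>\<phi>\<in>F. \<forall>x\<in>X. N x < \<delta> \<longrightarrow> cmod (\<phi> x) < e"
    unfolding eventually_at_right_field by blast
  then have "\<forall>\<phi>\<in>F. \<forall>x\<in>X. N x < d / 2 \<longrightarrow> cmod (\<phi> x) < e"
    by (metis half_gt_zero field_sum_of_halves less_add_same_cancel1)
  with \<open>0 < d\<close> show ?thesis
    by (intro exI[of _ "d / 2"]) simp
qed

lemma unit_mem: "(\<lambda>i. if i = n then 1 else 0) \<in> X"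
proof -
  obtain w where w: "w \<in> X" "\<And>i. w i \<noteq> 0"
    using ex_positive by blast
  show ?thesis
    by (rule solid[OF scale[OF w(1), of "1 / w n"]]) (use w(2) in simp)
qed

text \<open>Two kernel vectors of the remaining functionals with disjoint supports have a nontrivial
  combination that is also killed by the new functional.\<close>

lemma ex_common_kernel:
  assumes "finite F" "\<And>\<phi>. \<phi> \<in> F \<Longrightarrow> continuous_functional X N \<phi>"
  shows "\<exists>h\<in>X. \<exists>j. h j \<noteq> 0 \<and> n \<le> j \<and> (\<exists>m. \<forall>i. i < n \<or> m \<le> i \<longrightarrow> h i = 0) \<and> (\<forall>\<phi>\<in>F. \<phi> h = 0)"
  using assms
proof (induction F arbitrary: n rule: finite_induct)
  case empty
  show ?case
    by (intro bexI[OF _ unit_mem[of n]] exI[of _ n] conjI exI[of _ "Suc n"]) auto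
next
  case (insert \<phi> F)
  have \<phi>: "continuous_functional X N \<phi>"
    using insert.prems by simp
  obtain g j m where g: "g \<in> X" "g j \<noteq> 0" "n \<le> j" "\<And>i. i < n \<Longrightarrow> g i = 0" "\<And>i. m \<le> i \<Longrightarrow> g i = 0"
    "\<And>\<psi>. \<psi> \<in> F \<Longrightarrow> \<psi> g = 0"
    using insert.IH[of n] insert.prems by (metis insertI2)
  \<comment> \<open>Starting at \<open>max n m\<close> puts \<open>h\<close> past the support of
    \<open>g\<close>; hence the combination \<open>f\<close> agrees with \<open>h\<close> at
    \<open>k\<close> and is nonzero there.\<close>
  obtain h k l where h: "h \<in> X" "h k \<noteq> 0" "max n m \<le> k" "\<And>i. i < max n m \<Longrightarrow> h i = 0" "\<And>i. l \<le> i \<Longrightarrow> h i = 0"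
    "\<And>\<psi>. \<psi> \<in> F \<Longrightarrow> \<psi> h = 0"
    using insert.IH[of "max n m"] insert.prems by (metis insertI2)
  show ?case
  proof (cases "\<phi> g = 0")
    case True
    then show ?thesis
      using g by (intro bexI[OF _ g(1)] exI[of _ j] conjI exI[of _ m]) auto
  next
    case False
    define f where "f = (\<lambda>i. 1 * h i + (- \<phi> h / \<phi> g) * g i)"
    have "f \<in> X"
      unfolding f_def by (intro add scale g h)
    moreover have "f k \<noteq> 0"
      using h(2,3) g(5)[of k] by (simp add: f_def)
    moreover have "f i = 0" if "i < n \<or> max l m \<le> i" for i
      using that g(4,5) h(4,5) by (auto simp: f_def)
    moreover have "\<phi> f = 0"
      unfolding f_def continuous_functionalD[OF \<phi> h(1) g(1)] using False by simp
    moreover have "\<psi> f = 0" if "\<psi> \<in> F" for \<psi>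
    proof -
      have "continuous_functional X N \<psi>"
        using insert.prems that by simp
      then show ?thesis
        unfolding f_def by (simp only: continuous_functionalD h(1) g(1) g(6)[OF that] h(6)[OF that] mult_zero_right add_0_left)
    qed
    ultimately show ?thesis
      using h(3) by (intro bexI[of _ f] exI[of _ k] conjI exI[of _ "max l m"]) auto
  qed
qed

text \<open>First remove the zero coordinates of \<open>y\<close>, then move far along a vector
  \<open>h\<close> that all functionals in \<open>F\<close> kill. The coefficient becomes as large
  as desired while the functionals see no change, and splicing in a fixed point then lands in J at
  small cost.\<close>

lemma julia_set_weakly_dense:
  assumes y: "y \<in> X" and F: "finite F" "\<And>\<phi>. \<phi> \<in> F \<Longrightarrow> continuous_functional X N \<phi>" and e: "0 < e"
  shows "\<exists>z\<in>J. \<forall>\<phi>\<in>F. cmod (\<phi> z - \<phi> y) < e"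
proof -
  obtain \<delta> where \<delta>: "0 < \<delta>" "\<And>\<phi> x. \<phi> \<in> F \<Longrightarrow> x \<in> X \<Longrightarrow> N x < \<delta> \<Longrightarrow> cmod (\<phi> x) < e"
    using continuous_functionals_small[OF F e] by blast
  obtain x where x: "x \<in> X" "N (\<lambda>i. y i - x i) < \<delta> / 3" "\<And>i. x i \<noteq> 0"
    using ex_nonzero_approx[OF y, of "\<delta> / 3"] \<delta>(1) by auto
  obtain h j l where h: "h \<in> X" "h j \<noteq> 0" "\<And>i. l \<le> i \<Longrightarrow> h i = 0" "\<And>\<phi>. \<phi> \<in> F \<Longrightarrow> \<phi> h = 0"
    using ex_common_kernel[OF F, of 0] by metis
  have jl: "j < l"
    using h(2) h(3)[of j] by (meson not_le)
  have "\<forall>\<^sub>F m in sequentially. N (zero_below m x) < \<delta> / 3"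
    using \<delta>(1) by (intro order_tendstoD[OF N_zero_below[OF x(1)]]) auto
  then obtain k where "\<And>m. k \<le> m \<Longrightarrow> N (zero_below m x) < \<delta> / 3"
    by (auto simp: eventually_sequentially)
  \<comment> \<open>With \<open>l \<le> m\<close> the support of \<open>h\<close> lies below
    \<open>m\<close>, so the tail of \<open>u t\<close> is that of \<open>x\<close> for every
    \<open>t\<close>, and \<open>m\<close> can be fixed before \<open>t\<close>.\<close>
  then obtain m where m: "N (zero_below m x) < \<delta> / 3" "l \<le> m"
    by (meson max.cobounded1 max.cobounded2)
  define v where "v = geom_seq 2"
  have v: "v \<in> J" "v \<in> X"
    using geom_seq_mem_julia_set geom by (auto simp: v_def)
  define u where "u t = (\<lambda>i. x i + complex_of_real t * h i)" for t
  have "filterlim (\<lambda>t. cmod (iter_coeff m (u t))) at_top at_top"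
    unfolding u_def using x(3) jl m(2) h(2) by (intro filterlim_iter_coeff_line[where j = j]) auto
  then have "\<forall>\<^sub>F t in at_top. 3 * N v / \<delta> < cmod (iter_coeff m (u t))"
    unfolding filterlim_at_top_dense by blast
  then obtain t where t: "3 * N v / \<delta> < cmod (iter_coeff m (u t))"
    by (auto simp: eventually_at_top_linorder)
  have "0 \<le> 3 * N v / \<delta>"
    using N_nonneg[OF v(2)] \<delta>(1) by simp
  with t have c: "0 < cmod (iter_coeff m (u t))"
    by linarith
  have uX: "u t \<in> X"
    unfolding u_def by (intro add scale x h)
  let ?c = "iter_coeff m (u t)"
  define z where "z = splice_at m (u t) (\<lambda>i. v i / ?c)"
  have z: "z \<in> J" "z \<in> X"
    unfolding z_def using splice_at_divide_mem_julia_set[OF uX v(1)] c julia_set_subset by auto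
  have "zero_below m (u t) = zero_below m x"
    using h(3) m(2) by (auto simp: zero_below_def u_def)
  then have "N (\<lambda>i. u t i - z i) \<le> N (zero_below m x) + N v / cmod ?c"
    using N_diff_splice_at[OF uX divide_mem[OF v(2)], of m ?c] N_divide[OF v(2), of ?c]
    unfolding z_def by simp
  moreover have "N v / cmod ?c < \<delta> / 3"
    using t \<delta>(1) c by (simp add: field_simps)
  ultimately have uz: "N (\<lambda>i. u t i - z i) < 2 * \<delta> / 3"
    using m(1) by linarith
  \<comment> \<open>Chosen so that \<open>d + z = y + t h\<close>: the functionals in
    \<open>F\<close> see \<open>z\<close> and \<open>y\<close> differ only by the small vector
    \<open>d\<close>.\<close>
  define d where "d = (\<lambda>i. (y i - x i) + (u t i - z i))"
  have d: "d \<in> X"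
    unfolding d_def by (intro add diff x y uX z)
  have "N d < \<delta>"
    using N_triangle[OF diff[OF y x(1)] diff[OF uX z(2)]] uz x(2) unfolding d_def by simp
  then have small: "cmod (\<phi> d) < e" if "\<phi> \<in> F" for \<phi>
    using \<delta>(2)[OF that d] by simp
  have "\<phi> z - \<phi> y = - \<phi> d" if "\<phi> \<in> F" for \<phi>
  proof -
    note lin = continuous_functionalD[OF F(2)[OF that]]
    have "\<phi> (\<lambda>i. 1 * d i + 1 * z i) = \<phi> (\<lambda>i. 1 * y i + complex_of_real t * h i)"
      by (simp add: d_def u_def)
    then have "\<phi> d + \<phi> z = \<phi> y"
      unfolding lin[OF d z(2)] lin[OF y h(1)] using h(4)[OF that] by simp
    then show ?thesis
      by (simp add: algebra_simps)
  qed
  then show ?thesis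
    using small z(1) by (intro bexI[of _ z]) auto
qed

section \<open>Vectors whose orbit is dense in the Julia set\<close>

lemma Orb_subset: "x \<in> X \<Longrightarrow> Orb shift_poly x \<subseteq> X"
  by (auto simp: Orb_def funpow_mem)

context
  fixes x0
  assumes x0: "x0 \<in> J" and dense: "dense_in (subtopology T J) (Orb shift_poly x0)"
begin

lemma x0_mem: "x0 \<in> X"
  using x0 julia_set_subset by auto

lemma Orb_approx: "y \<in> J \<Longrightarrow> 0 < e \<Longrightarrow> \<exists>z\<in>Orb shift_poly x0. N (\<lambda>i. y i - z i) < e"
  using dense unfolding dense_in_subtopology_iff[OF julia_set_subset] by blast

text \<open>A nonempty weakly open set contains a point of J and is also norm open, so the norm
  density of the orbit in J suffices.\<close>

lemma weakly_hypercyclic: "weakly_hypercyclic_vector X N shift_poly x0"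
  unfolding weakly_hypercyclic_vector_def dense_in_def dense_intersects_open
proof (intro conjI allI impI)
  fix W
  assume W: "openin (weak_topology X N) W \<and> W \<noteq> {}"
  then obtain y where y: "y \<in> W"
    by blast
  then have yX: "y \<in> X"
    using W openin_subset topspace_weak by blast
  obtain F e where "finite F" "\<forall>\<phi>\<in>F. continuous_functional X N \<phi>" "0 < e"
    "\<forall>z\<in>X. (\<forall>\<phi>\<in>F. cmod (\<phi> z - \<phi> y) < e) \<longrightarrow> z \<in> W"
    using openin_weakD[of W y] W y by blast
  then obtain z where z: "z \<in> J" "z \<in> W"
    using julia_set_weakly_dense[OF yX, of F e] julia_set_subset by blast
  have "openin (subtopology T X) W"
    using openin_weak_imp_openin W by (metis subtopology_topspace topspace_T)
  then obtain e' where "e' > 0" "\<And>x. x \<in> X \<Longrightarrow> N (\<lambda>i. z i - x i) < e' \<Longrightarrow> x \<in> W"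
    using openin_subtopologyD[OF order_refl _ z(2)] by blast
  then show "Orb shift_poly x0 \<inter> W \<noteq> {}"
    using Orb_approx[OF z(1)] Orb_subset[OF x0_mem] by blast
qed (use x0_mem Orb_subset topspace_weak in auto)

text \<open>Adding to \<open>y\<close> a copy of the fixed point \<open>geom_seq a\<close>, with phases aligned to those of \<open>y\<close>,
  makes every coordinate at least as large as that of the fixed point.\<close>

lemma d_hypercyclic:
  assumes a: "1 < a" "N (geom_seq a) < d"
  shows "d_hypercyclic_vector d X N shift_poly x0"
  unfolding d_hypercyclic_vector_def
proof (intro conjI ballI)
  let ?w = "geom_seq a"
  have w: "?w \<in> X" "?w \<in> J"
    using a geom geom_seq_mem_julia_set by auto
  show "0 < d"
    using a(2) N_nonneg[OF w(1)] by simp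
  show "x0 \<in> X"
    by (rule x0_mem)
  fix y
  assume y: "y \<in> X"
  \<comment> \<open>Since \<open>sgn 0 = 0\<close>, the phase 1 is prescribed where
    \<open>y i\<close> vanishes.\<close>
  define x where "x = (\<lambda>i. y i + (if y i = 0 then 1 else sgn (y i)) * ?w i)"
  have "cmod (x i - y i) \<le> 1 * cmod (?w i)" for i
    by (simp add: x_def norm_mult norm_sgn)
  from dominated_approx[OF w(1) y this]
  have x: "x \<in> X" "N (\<lambda>i. x i - y i) \<le> N ?w"
    by auto
  \<comment> \<open>Half the slack: one \<open>e\<close> for splicing into J, one for approximating
    by the orbit.\<close>
  define e where "e = (d - N ?w) / 2"
  have e: "0 < e"
    using a by (simp add: e_def)
  have "cmod (?w i) \<le> cmod (x i)" for i
  proof (cases "y i = 0")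
    case False
    have "x i = sgn (y i) * complex_of_real (cmod (y i) + a * (1 / a) ^ i)"
      using False by (simp add: x_def geom_seq_def sgn_eq algebra_simps)
    then have "cmod (x i) = \<bar>cmod (y i) + a * (1 / a) ^ i\<bar>"
      using False by (simp only: norm_mult norm_sgn norm_of_real) simp
    then show ?thesis
      using a by (simp add: geom_seq_def norm_mult norm_divide norm_power)
  qed (simp add: x_def)
  then have "a ^ n \<le> cmod (iter_coeff n x)" for n
    using iter_coeff_mono[of n ?w x] iter_coeff_geom_seq[of a n] a(1) by (simp add: norm_power)
  moreover have "filterlim (\<lambda>n. a ^ n) at_top sequentially"
    using a(1) filterlim_at_infinity_imp_filterlim_at_top[OF filterlim_realpow_sequentially_gt1[of a]] by auto
  ultimately have "filterlim (\<lambda>n. cmod (iter_coeff n x)) at_top sequentially"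
    by (elim filterlim_at_top_mono) (auto intro: always_eventually)
  from eventually_near_splice_at[OF x(1) w(1) e this]
  obtain m where m: "iter_coeff m x \<noteq> 0"
    "N (\<lambda>i. x i - splice_at m x (\<lambda>i. ?w i / iter_coeff m x) i) < e"
    by (auto simp: eventually_sequentially)
  let ?z = "splice_at m x (\<lambda>i. ?w i / iter_coeff m x)"
  have z: "?z \<in> J" "?z \<in> X"
    using splice_at_divide_mem_julia_set[OF x(1) w(2) m(1)] julia_set_subset by auto
  obtain z' where z': "z' \<in> Orb shift_poly x0" "N (\<lambda>i. ?z i - z' i) < e"
    using Orb_approx[OF z(1) e] by blast
  have z'X: "z' \<in> X"
    using z' Orb_subset[OF x0_mem] by auto
  have "N (\<lambda>i. y i - z' i) \<le> N (\<lambda>i. y i - x i) + N (\<lambda>i. x i - ?z i) + N (\<lambda>i. ?z i - z' i)"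
    using N_diff_triangle[OF y x(1) z'X] N_diff_triangle[OF x(1) z(2) z'X] by simp
  also have "\<dots> < N ?w + e + e"
    using x(2) m(2) z'(2) N_diff_commute[OF x(1) y] by simp
  finally show "\<exists>z\<in>Orb shift_poly x0. N (\<lambda>i. y i - z i) < d"
    using z'(1) by (auto simp: e_def)
qed

text \<open>Dividing a vector \<open>x\<close> near \<open>y\<close> by a small
  \<open>\<gamma>\<close> does not decrease the moduli of its coefficients. Splice a fixed point
  into \<open>x / \<gamma>\<close> and multiply back by \<open>\<gamma>\<close>: the inserted tail
  is scaled by \<open>cmod \<gamma>\<close> and becomes negligible, with \<open>m\<close> fixed
  beforehand.\<close>

lemma supercyclic_small:
  assumes \<Gamma>: "0 islimpt \<Gamma>"
  shows "supercyclic_vector \<Gamma> X N shift_poly x0"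
  unfolding supercyclic_vector_def dense_in_iff
proof (intro conjI ballI allI impI)
  show "x0 \<in> X"
    by (rule x0_mem)
  show "{\<lambda>i. \<gamma> * z i |\<gamma> z. \<gamma> \<in> \<Gamma> \<and> z \<in> Orb shift_poly x0} \<subseteq> X"
    using Orb_subset[OF x0_mem] scale by blast
  fix y and e :: real
  assume y: "y \<in> X" and e: "0 < e"
  obtain x where x: "x \<in> X" "N (\<lambda>i. y i - x i) < e / 4" "\<And>i. x i \<noteq> 0"
    using ex_nonzero_approx[OF y, of "e / 4"] e by auto
  have "\<forall>\<^sub>F m in sequentially. N (zero_below m x) < e / 4"
    using e by (intro order_tendstoD[OF N_zero_below[OF x(1)]]) auto
  then obtain m where m: "N (zero_below m x) < e / 4"
    by (auto simp: eventually_sequentially)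
  define v where "v = geom_seq 2"
  have v: "v \<in> J" "v \<in> X" "0 \<le> N v"
    using geom_seq_mem_julia_set geom N_nonneg by (auto simp: v_def)
  let ?c = "iter_coeff m x"
  have c: "?c \<noteq> 0"
    using x(3) by (simp add: iter_coeff_eq_0_iff)
  \<comment> \<open>The bound 1 keeps coefficients from shrinking and the orbit error from growing
    under multiplication by \<open>\<gamma>\<close>; the other bound makes the scaled tail smaller
    than \<open>e / 4\<close>.\<close>
  define \<eta> where "\<eta> = min 1 (e / 4 * cmod ?c / (N v + 1))"
  have \<eta>: "0 < \<eta>"
    using e c v(3) by (simp add: \<eta>_def)
  then obtain \<gamma> where \<gamma>: "\<gamma> \<in> \<Gamma>" "\<gamma> \<noteq> 0" "cmod \<gamma> < \<eta>"
    using \<Gamma> unfolding islimpt_approachable by (auto simp: dist_norm)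
  define x' where "x' = (\<lambda>i. x i / \<gamma>)"
  have x': "x' \<in> X"
    unfolding x'_def by (rule divide_mem[OF x(1)])
  let ?c' = "iter_coeff m x'"
  have x_x': "x = (\<lambda>i. \<gamma> * x' i)"
    using \<gamma>(2) by (simp add: x'_def)
  have "\<gamma> * ?c = \<gamma> ^ (2 ^ m) * ?c'"
    unfolding x_x' by (rule iter_coeff_scale)
  then have cc: "cmod \<gamma> * cmod ?c = cmod \<gamma> ^ (2 ^ m) * cmod ?c'"
    by (metis norm_mult norm_power)
  have c': "?c' \<noteq> 0"
    using x(3) \<gamma>(2) by (simp add: iter_coeff_eq_0_iff x'_def)
  have \<gamma>1: "cmod \<gamma> \<le> 1"
    using \<gamma>(3) by (simp add: \<eta>_def)
  have "cmod \<gamma> * cmod ?c \<le> cmod \<gamma> * cmod ?c'"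
    unfolding cc using \<gamma>1 power_decreasing[of 1 "2 ^ m" "cmod \<gamma>"] by (intro mult_right_mono) auto
  then have "cmod ?c \<le> cmod ?c'"
    using \<gamma>(2) by simp
  then have "cmod \<gamma> * (N v / cmod ?c') \<le> cmod \<gamma> * (N v / cmod ?c)"
    using v(3) c c' by (intro mult_left_mono divide_left_mono) auto
  also have "\<dots> \<le> cmod \<gamma> * ((N v + 1) / cmod ?c)"
    by (intro mult_left_mono divide_right_mono) auto
  also have "\<dots> < e / 4"
    using \<gamma>(3) c v(3) by (simp add: \<eta>_def field_simps)
  finally have tail: "cmod \<gamma> * (N v / cmod ?c') < e / 4" .
  define z where "z = splice_at m x' (\<lambda>i. v i / ?c')"
  have z: "z \<in> J" "z \<in> X"
    unfolding z_def using splice_at_divide_mem_julia_set[OF x' v(1) c'] julia_set_subset by auto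
  have zb: "zero_below m x = (\<lambda>i. \<gamma> * zero_below m x' i)"
    unfolding x_x' by (auto simp: zero_below_def)
  have "N (\<lambda>i. x i - \<gamma> * z i) = cmod \<gamma> * N (\<lambda>i. x' i - z i)"
    using N_scale[OF diff[OF x' z(2)], of \<gamma>] by (simp add: x_x' right_diff_distrib)
  also have "\<dots> \<le> cmod \<gamma> * (N (zero_below m x') + N v / cmod ?c')"
    using N_diff_splice_at[OF x' divide_mem[OF v(2)], of m ?c'] N_divide[OF v(2), of ?c']
    unfolding z_def by (intro mult_left_mono) auto
  also have "\<dots> = N (zero_below m x) + cmod \<gamma> * (N v / cmod ?c')"
    unfolding zb by (simp add: N_scale[OF zero_below_mem[OF x']] distrib_left)
  finally have xz: "N (\<lambda>i. x i - \<gamma> * z i) < e / 2"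
    using m tail by linarith
  obtain z' where z': "z' \<in> Orb shift_poly x0" "N (\<lambda>i. z i - z' i) < e / 4"
    using Orb_approx[OF z(1), of "e / 4"] e by auto
  have z'X: "z' \<in> X"
    using z' Orb_subset[OF x0_mem] by auto
  have "N (\<lambda>i. \<gamma> * z i - \<gamma> * z' i) = cmod \<gamma> * N (\<lambda>i. z i - z' i)"
    using N_scale[OF diff[OF z(2) z'X], of \<gamma>] by (simp add: right_diff_distrib)
  also have "\<dots> \<le> N (\<lambda>i. z i - z' i)"
    using \<gamma>1 N_nonneg[OF diff[OF z(2) z'X]] by (simp add: mult_left_le_one_le)
  finally have zz: "N (\<lambda>i. \<gamma> * z i - \<gamma> * z' i) < e / 4"
    using z'(2) by simp
  have "N (\<lambda>i. y i - \<gamma> * z' i) \<le> N (\<lambda>i. y i - x i) + N (\<lambda>i. x i - \<gamma> * z i) + N (\<lambda>i. \<gamma> * z i - \<gamma> * z' i)"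
    using N_diff_triangle[OF y x(1) scale[OF z'X, of \<gamma>]]
      N_diff_triangle[OF x(1) scale[OF z(2), of \<gamma>] scale[OF z'X, of \<gamma>]] by simp
  also have "\<dots> < e"
    using x(2) xz zz by simp
  finally show "\<exists>z\<in>{\<lambda>i. \<gamma> * z i |\<gamma> z. \<gamma> \<in> \<Gamma> \<and> z \<in> Orb shift_poly x0}. N (\<lambda>i. y i - z i) < e"
    using \<gamma>(1) z'(1) by (intro bexI[of _ "\<lambda>i. \<gamma> * z' i"]) auto
qed

end

text \<open>Baire's theorem on the whole space, for the maps sending \<open>x\<close> to
  \<open>\<gamma>\<close> times an iterate of \<open>x\<close>. To reach \<open>v\<close>, the
  iterate only has to hit \<open>v / \<gamma>\<close>; a large \<open>\<gamma>\<close> makes the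
  spliced tail small, so no growth of coefficients is required.\<close>

lemma supercyclic_unbounded:
  assumes \<Gamma>: "\<not> bounded \<Gamma>"
  shows "supercyclic \<Gamma> X N shift_poly"
proof -
  define f where "f = (\<lambda>(\<gamma>, n) x i. \<gamma> * (shift_poly ^^ n) x i)"
  have "\<exists>x\<in>topspace T. dense_in T ((\<lambda>g. g x) ` f ` (\<Gamma> \<times> UNIV))"
  proof (rule ex_dense_family_orbit[OF completely_metrizable_T second_countable_T])
    show "topspace T \<noteq> {}"
      using zero_mem by auto
    show "continuous_map T T g" if g: "g \<in> f ` (\<Gamma> \<times> UNIV)" for g
    proof -
      obtain \<gamma> n where "g = (\<lambda>x i. \<gamma> * x i) \<circ> (shift_poly ^^ n)"
        using g by (auto simp: f_def fun_eq_iff)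
      then show ?thesis
        using continuous_map_compose[OF continuous_map_funpow continuous_map_scale] by simp
    qed
    fix U V
    assume U: "openin T U" "U \<noteq> {}" and V: "openin T V" "V \<noteq> {}"
    then obtain u v where uv: "u \<in> U" "v \<in> V"
      by auto
    then have uX: "u \<in> X" and vX: "v \<in> X"
      using U V openin_subset by fastforce+
    obtain e where e: "e > 0" "\<And>x. x \<in> X \<Longrightarrow> N (\<lambda>i. u i - x i) < e \<Longrightarrow> x \<in> U"
      using openin_subtopologyD[OF order_refl _ uv(1)] U(1) by (metis subtopology_topspace topspace_T)
    obtain x where x: "x \<in> X" "N (\<lambda>i. u i - x i) < e / 3" "\<And>i. x i \<noteq> 0"
      using ex_nonzero_approx[OF uX, of "e / 3"] e(1) by auto
    have "\<forall>\<^sub>F m in sequentially. N (zero_below m x) < e / 3"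
      using e by (intro order_tendstoD[OF N_zero_below[OF x(1)]]) auto
    then obtain m where m: "N (zero_below m x) < e / 3"
      by (auto simp: eventually_sequentially)
    let ?c = "iter_coeff m x"
    have c: "?c \<noteq> 0"
      using x(3) by (simp add: iter_coeff_eq_0_iff)
    \<comment> \<open>Chosen after \<open>m\<close>, so that it can compensate a small coefficient
      \<open>?c\<close>.\<close>
    obtain \<gamma> where \<gamma>: "\<gamma> \<in> \<Gamma>" "3 * N v / (e * cmod ?c) < cmod \<gamma>"
      using \<Gamma> unfolding bounded_iff by (meson not_le)
    have "0 \<le> 3 * N v / (e * cmod ?c)"
      using e(1) N_nonneg[OF vX] by simp
    with \<gamma>(2) have \<gamma>0: "0 < cmod \<gamma>"
      by linarith
    define v' where "v' = (\<lambda>i. v i / \<gamma>)"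
    have v': "v' \<in> X" "N v' = N v / cmod \<gamma>"
      unfolding v'_def by (rule divide_mem[OF vX], rule N_divide[OF vX])
    define z where "z = splice_at m x (\<lambda>i. v' i / ?c)"
    have z: "z \<in> X"
      unfolding z_def by (intro splice_at_mem divide_mem x v')
    have "N (\<lambda>i. x i - z i) \<le> N (zero_below m x) + N v / cmod \<gamma> / cmod ?c"
      using N_diff_splice_at[OF x(1) divide_mem[OF v'(1)], of m ?c] N_divide[OF v'(1), of ?c]
      unfolding z_def v'(2) by simp
    also have "N v / cmod \<gamma> / cmod ?c < e / 3"
      using \<gamma>(2) \<gamma>0 c e(1) by (simp add: field_simps)
    finally have "N (\<lambda>i. u i - z i) < e"
      using N_diff_triangle[OF uX x(1) z] x(2) m by simp
    then have "z \<in> U"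
      using e(2) z by simp
    moreover have "f (\<gamma>, m) z = v"
      using funpow_shift_poly_splice_at[OF c, of v'] \<gamma>0 by (simp add: f_def z_def v'_def)
    ultimately show "\<exists>g\<in>f ` (\<Gamma> \<times> UNIV). g ` U \<inter> V \<noteq> {}"
      using \<gamma>(1) uv(2) by blast
  qed
  moreover have "(\<lambda>g. g x) ` f ` (\<Gamma> \<times> UNIV) = {\<lambda>i. \<gamma> * z i |\<gamma> z. \<gamma> \<in> \<Gamma> \<and> z \<in> Orb shift_poly x}" for x
    by (force simp: f_def Orb_def)
  ultimately show ?thesis
    unfolding supercyclic_def supercyclic_vector_def by auto
qed

text \<open>In degree 2 the limit radius is the reciprocal of the polynomial norm, so an upper bound
  on the norm bounds it from below once the norm is known to be positive.\<close>

lemma limit_radius_ge: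
  assumes C: "\<And>x. x \<in> X \<Longrightarrow> N x \<le> 1 \<Longrightarrow> N (shift_poly x) \<le> C"
  shows "1 / C \<le> limit_radius 2 X N shift_poly"
proof -
  define w where "w = geom_seq 2"
  have w: "w \<in> X" "w \<in> J" "shift_poly w = w"
    using geom[of 2] geom_seq_mem_julia_set[of 2]
    by (auto simp: w_def fun_eq_iff shift_poly_def backward_shift_def geom_seq_def)
  have Nw: "1 \<le> N w"
    using w(2) unfolding julia_set_eq by (auto dest: spec[of _ 0])
  \<comment> \<open>A normalised fixed point: homogeneity gives its image the norm
    \<open>1 / N w\<close>, which shows that P has positive norm.\<close>
  define x where "x = (\<lambda>i. inverse (complex_of_real (N w)) * w i)"
  have x: "x \<in> X" "N x = 1"
    using scale[OF w(1)] N_scale[OF w(1)] Nw by (auto simp: x_def norm_inverse)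
  have "N (shift_poly x) = (inverse (N w))\<^sup>2 * N w"
    unfolding x_def shift_poly_homogeneous w(3) N_scale[OF w(1)]
    using Nw by (simp add: norm_power norm_inverse)
  then have "0 < N (shift_poly x)"
    using Nw by simp
  also have "\<dots> \<le> poly_norm X N shift_poly"
    unfolding poly_norm_def using x C by (intro cSUP_upper) (auto intro!: bdd_aboveI2)
  finally have pos: "0 < poly_norm X N shift_poly" .
  have "poly_norm X N shift_poly \<le> C"
    unfolding poly_norm_def using x C by (intro cSUP_least) auto
  then have "1 / C \<le> 1 / poly_norm X N shift_poly"
    using pos by (intro divide_left_mono) auto
  also have "\<dots> = limit_radius 2 X N shift_poly"
    using pos by (simp add: limit_radius_def powr_minus_divide)
  finally show ?thesis .
qed

text \<open>The radius \<open>r\<close> enters only through the existence of fixed points of norm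
  below every \<open>d > r\<close>; this is what each concrete space has to provide for its limit
  radius.\<close>

lemma julia_set_dynamics:
  assumes r: "\<And>d. r < d \<Longrightarrow> \<exists>a>1. N (geom_seq a) < d"
  shows "chaotic (subtopology T J) shift_poly \<and>
         (\<forall>x0\<in>J. dense_in (subtopology T J) (Orb shift_poly x0) \<longrightarrow>
            weakly_hypercyclic_vector X N shift_poly x0 \<and>
            (\<forall>d > r. d_hypercyclic_vector d X N shift_poly x0) \<and>
            (\<forall>\<Gamma>. 0 islimpt \<Gamma> \<longrightarrow> supercyclic_vector \<Gamma> X N shift_poly x0)) \<and>
         (\<forall>\<Gamma>. \<not> bounded \<Gamma> \<longrightarrow> supercyclic \<Gamma> X N shift_poly)"
proof (intro conjI ballI impI allI)
  fix x0 d
  assume "x0 \<in> J" "dense_in (subtopology T J) (Orb shift_poly x0)" "r < d"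
  then show "d_hypercyclic_vector d X N shift_poly x0"
    using r[of d] d_hypercyclic by blast
qed (simp_all add: chaotic_julia_set weakly_hypercyclic supercyclic_small supercyclic_unbounded)

end

section \<open>The spaces $c_0$ and $\ell_p$\<close>

lemma c0_norm_le: "(\<And>i. cmod (x i) \<le> c) \<Longrightarrow> c0_norm x \<le> c"
  unfolding c0_norm_def by (rule cSUP_least) auto

lemma c0_solid:
  assumes "y \<in> c0_space" "\<And>i. cmod (x i) \<le> cmod (y i)"
  shows "x \<in> c0_space"
  using assms unfolding c0_space_def
  by (auto intro!: Lim_null_comparison[of x "\<lambda>i. cmod (y i)"] tendsto_norm_zero)

lemma normed_seq_space_c0: "normed_seq_space c0_space c0_norm"
proof (rule normed_seq_space.intro)
  fix x y :: cseq and c :: complex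
  assume x: "x \<in> c0_space"
  show mem: "(\<lambda>i. c * x i) \<in> c0_space" for c
    using x by (auto simp: c0_space_def intro: tendsto_mult_right_zero)
  show "c0_norm (\<lambda>i. c * x i) = cmod c * c0_norm x"
  proof (rule antisym)
    show "c0_norm (\<lambda>i. c * x i) \<le> cmod c * c0_norm x"
      using c0_le_norm[OF x] by (intro c0_norm_le) (simp add: norm_mult mult_left_mono)
    show "cmod c * c0_norm x \<le> c0_norm (\<lambda>i. c * x i)"
    proof (cases "c = 0")
      case False
      have "cmod (x i) \<le> c0_norm (\<lambda>i. c * x i) / cmod c" for i
        using c0_le_norm[OF mem, of c i] False by (simp add: norm_mult field_simps)
      then have "c0_norm x \<le> c0_norm (\<lambda>i. c * x i) / cmod c"
        by (rule c0_norm_le)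
      then show ?thesis
        using False by (simp add: field_simps)
    qed (simp add: c0_norm_def)
  qed
  show "cmod (x i) \<le> c0_norm x" for i
    by (rule c0_le_norm[OF x])
  show b: "backward_shift x \<in> c0_space"
    using x LIMSEQ_Suc by (simp add: c0_space_def backward_shift_def)
  show "c0_norm (backward_shift x) \<le> c0_norm x"
    using c0_le_norm[OF x] by (intro c0_norm_le) (simp add: backward_shift_def)
  have "(\<lambda>i. splice_at 1 (\<lambda>_. 0) x (Suc i)) = x"
    by (simp add: splice_at_def)
  then show "splice_at 1 (\<lambda>_. 0) x \<in> c0_space"
    using x LIMSEQ_imp_Suc[of "splice_at 1 (\<lambda>_. 0) x" 0] by (simp add: c0_space_def)
  show "c0_norm (splice_at 1 (\<lambda>_. 0) x) \<le> c0_norm x"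
    using c0_le_norm[OF x] order_trans[OF norm_ge_zero c0_le_norm[OF x]]
    by (intro c0_norm_le) (simp add: splice_at_def)
  show "(\<lambda>m. c0_norm (zero_below m x)) \<longlonglongrightarrow> 0"
  proof (rule LIMSEQ_I)
    fix e :: real
    assume e: "0 < e"
    obtain k where k: "\<And>i. k \<le> i \<Longrightarrow> cmod (x i) < e / 2"
      using x LIMSEQ_D[of x 0 "e / 2"] e by (auto simp: c0_space_def)
    have "norm (c0_norm (zero_below m x) - 0) < e" if "k \<le> m" for m
    proof -
      have "cmod (zero_below m x i) \<le> e / 2" for i
        using less_imp_le[OF k[of i]] that e by (auto simp: zero_below_def)
      then have "c0_norm (zero_below m x) \<le> e / 2"
        by (rule c0_norm_le)
      moreover have "zero_below m x \<in> c0_space"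
        by (rule c0_solid[OF x]) (simp add: zero_below_def)
      then have "0 \<le> c0_norm (zero_below m x)"
        using c0_le_norm norm_ge_zero order_trans by blast
      ultimately show ?thesis
        using e by simp
    qed
    then show "\<exists>k. \<forall>m\<ge>k. norm (c0_norm (zero_below m x) - 0) < e"
      by blast
  qed
  show "(\<lambda>i. y i + x i) \<in> c0_space" if "y \<in> c0_space"
    using that x tendsto_add[of y 0 sequentially x 0] by (simp add: c0_space_def)
  show "c0_norm (\<lambda>i. y i + x i) \<le> c0_norm y + c0_norm x" if "y \<in> c0_space"
    by (rule c0_norm_triangle[OF that x])
next
  fix x y :: cseq
  assume y: "y \<in> c0_space" and le: "\<And>i. cmod (x i) \<le> cmod (y i)"
  show "x \<in> c0_space"
    using c0_solid[OF y le] .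
  show "c0_norm x \<le> c0_norm y"
    using le c0_le_norm[OF y] order_trans by (intro c0_norm_le) blast
next
  fix s :: "nat \<Rightarrow> cseq"
  assume s: "\<And>n. s n \<in> c0_space"
    and cauchy: "\<And>e. 0 < e \<Longrightarrow> \<exists>K. \<forall>m\<ge>K. \<forall>n\<ge>K. c0_norm (\<lambda>i. s m i - s n i) < e"
  have coord: "cmod (s m i - s n i) \<le> c0_norm (\<lambda>i. s m i - s n i)" for m n i
    using c0_le_norm[OF c0_diff[OF s s]] .
  have "Cauchy (\<lambda>n. s n i)" for i
  proof (rule CauchyI)
    show "\<exists>M. \<forall>m\<ge>M. \<forall>n\<ge>M. cmod (s m i - s n i) < e" if "0 < e" for e
      using cauchy[OF that] coord[of _ i] by (meson le_less_trans)
  qed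
  then obtain x where x: "\<And>i. (\<lambda>n. s n i) \<longlonglongrightarrow> x i"
    unfolding Cauchy_convergent_iff convergent_def by metis
  \<comment> \<open>Letting \<open>m\<close> tend to infinity in the Cauchy estimate keeps it
    uniform in the coordinate \<open>i\<close>.\<close>
  have near: "\<exists>K. \<forall>n\<ge>K. \<forall>i. cmod (s n i - x i) \<le> e" if e: "0 < e" for e
  proof -
    obtain K where K: "\<And>m n. K \<le> m \<Longrightarrow> K \<le> n \<Longrightarrow> c0_norm (\<lambda>i. s m i - s n i) < e"
      using cauchy[OF e] by blast
    have "cmod (s n i - x i) \<le> e" if n: "K \<le> n" for n i
    proof (rule LIMSEQ_le_const2)
      show "(\<lambda>m. cmod (s n i - s m i)) \<longlonglongrightarrow> cmod (s n i - x i)"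
        by (intro tendsto_intros x)
      show "\<exists>M. \<forall>m\<ge>M. cmod (s n i - s m i) \<le> e"
        using K[OF n] coord[of n i] by (meson le_less_trans less_imp_le)
    qed
    then show ?thesis
      by blast
  qed
  have xc: "x \<in> c0_space"
    unfolding c0_space_def
  proof (safe intro!: LIMSEQ_I)
    fix e :: real
    assume e: "0 < e"
    obtain K where K: "\<And>i. cmod (s K i - x i) \<le> e / 2"
      using near[of "e / 2"] e by auto
    obtain M where M: "\<And>i. M \<le> i \<Longrightarrow> cmod (s K i) < e / 2"
      using s[of K] LIMSEQ_D[of "s K" 0 "e / 2"] e by (auto simp: c0_space_def)
    have "norm (x i - 0) < e" if "M \<le> i" for i
      using K[of i] M[OF that] norm_triangle_ineq3[of "x i" "s K i"] by (simp add: norm_minus_commute)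
    then show "\<exists>M. \<forall>i\<ge>M. norm (x i - 0) < e"
      by blast
  qed
  show "\<exists>x\<in>c0_space. (\<lambda>n. c0_norm (\<lambda>i. s n i - x i)) \<longlonglongrightarrow> 0"
  proof (intro bexI[OF _ xc] LIMSEQ_I)
    fix e :: real
    assume e: "0 < e"
    then obtain K where "\<And>n i. K \<le> n \<Longrightarrow> cmod (s n i - x i) \<le> e / 2"
      using near[of "e / 2"] by auto
    then have "c0_norm (\<lambda>i. s n i - x i) \<le> e / 2" if "K \<le> n" for n
      using that by (intro c0_norm_le) auto
    then have "c0_norm (\<lambda>i. s n i - x i) < e" if "K \<le> n" for n
      using that e by fastforce
    moreover have "0 \<le> c0_norm (\<lambda>i. s n i - x i)" for n
      using c0_le_norm[OF c0_diff[OF s xc]] norm_ge_zero order_trans by blast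
    ultimately show "\<exists>K. \<forall>n\<ge>K. norm (c0_norm (\<lambda>i. s n i - x i) - 0) < e"
      by (intro exI[of _ K]) auto
  qed
next
  fix a :: real
  assume a: "1 < a"
  have "(\<lambda>i. a * (1 / a) ^ i) \<longlonglongrightarrow> 0"
    using a by (intro tendsto_mult_right_zero LIMSEQ_realpow_zero) auto
  then have "(\<lambda>i. complex_of_real (a * (1 / a) ^ i)) \<longlonglongrightarrow> complex_of_real 0"
    by (rule tendsto_of_real)
  then show "geom_seq a \<in> c0_space"
    by (simp add: c0_space_def geom_seq_def)
qed (rule Metric_space_c0)

text \<open>Here the polynomial norm is at most 1, so \<open>d > 1\<close>, and
  \<open>geom_seq a\<close> has norm at most \<open>a\<close> for any \<open>a\<close> strictly
  between 1 and \<open>d\<close>. The value \<open>a = 1\<close> is excluded: it gives a constant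
  sequence outside c_0.\<close>

lemma ex_geom_seq_c0:
  assumes "limit_radius 2 c0_space c0_norm shift_poly < d"
  shows "\<exists>a>1. c0_norm (geom_seq a) < d"
proof -
  interpret normed_seq_space c0_space c0_norm
    by (rule normed_seq_space_c0)
  have "c0_norm (shift_poly x) \<le> 1" if "x \<in> c0_space" "c0_norm x \<le> 1" for x
    using N_shift_poly[OF that(1)] that(2) N_nonneg[OF that(1)] by (meson order_trans power_le_one)
  then have d: "1 < d"
    using limit_radius_ge[of 1] assms by simp
  let ?a = "(1 + d) / 2"
  have "cmod (geom_seq ?a i) \<le> ?a" for i
    using d by (simp add: geom_seq_def norm_mult norm_divide norm_power mult_right_le_one_le power_le_one
        del: of_real_add of_real_divide)
  then have "c0_norm (geom_seq ?a) \<le> ?a"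
    by (rule c0_norm_le)
  then show ?thesis
    using d by (intro exI[of _ ?a]) auto
qed

section \<open>The spaces l_p\<close>

lemma lp_solid:
  assumes p: "1 \<le> p" and y: "y \<in> lp_space p" and le: "\<And>i. cmod (x i) \<le> cmod (y i)"
  shows "x \<in> lp_space p" "lp_norm p x \<le> lp_norm p y"
proof -
  have le': "cmod (x i) powr p \<le> cmod (y i) powr p" for i
    using le p by (intro powr_mono2) auto
  then show x: "x \<in> lp_space p"
    using y unfolding lp_space_def by (auto intro: summable_comparison_test')
  show "lp_norm p x \<le> lp_norm p y"
    unfolding lp_norm_def using p x y le le'
    by (intro powr_mono2 suminf_le suminf_nonneg) (auto simp: lp_space_def)
qed

lemma lp_coord:
  assumes "1 \<le> p" "x \<in> lp_space p"
  shows "cmod (x i) \<le> lp_norm p x"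
proof -
  have "cmod (x i) powr p \<le> (\<Sum>i. cmod (x i) powr p)"
    using sum_le_suminf[of "\<lambda>i. cmod (x i) powr p" "{i}"] assms by (simp add: lp_space_def)
  then have "(cmod (x i) powr p) powr (1 / p) \<le> lp_norm p x"
    unfolding lp_norm_def using assms by (intro powr_mono2) auto
  then show ?thesis
    using assms by (simp add: powr_powr)
qed

text \<open>Bounds on finite sums survive coordinatewise limits, which is how the limit of a Cauchy
  sequence is controlled.\<close>

lemma lp_norm_leI:
  assumes p: "1 \<le> p" and c: "0 \<le> c" and le: "\<And>k. (\<Sum>i<k. cmod (x i) powr p) \<le> c powr p"
  shows "x \<in> lp_space p" "lp_norm p x \<le> c"
proof -
  have s: "summable (\<lambda>i. cmod (x i) powr p)"
    by (rule summableI_nonneg_bounded[OF _ le]) simp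
  then show "x \<in> lp_space p"
    by (simp add: lp_space_def)
  have "(\<Sum>i. cmod (x i) powr p) \<le> c powr p"
    by (rule suminf_le_const[OF s le])
  then have "lp_norm p x \<le> (c powr p) powr (1 / p)"
    unfolding lp_norm_def using p s by (intro powr_mono2 suminf_nonneg) auto
  then show "lp_norm p x \<le> c"
    using p c by (simp add: powr_powr)
qed

lemma lp_norm_le_powrD:
  assumes "1 \<le> p" "lp_norm p x powr p \<le> lp_norm p y powr p"
  shows "lp_norm p x \<le> lp_norm p y"
proof (rule ccontr)
  assume "\<not> lp_norm p x \<le> lp_norm p y"
  then have "lp_norm p y powr p < lp_norm p x powr p"
    using assms(1) lp_norm_nonneg by (intro powr_less_mono2) auto
  then show False
    using assms(2) by simp
qed

lemma lp_backward_shift: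
  assumes p: "1 \<le> p" and x: "x \<in> lp_space p"
  shows "backward_shift x \<in> lp_space p"
    "cmod (x 0) powr p + lp_norm p (backward_shift x) powr p = lp_norm p x powr p"
proof -
  show b: "backward_shift x \<in> lp_space p"
    using x summable_Suc_iff[of "\<lambda>i. cmod (x i) powr p"] by (simp add: lp_space_def backward_shift_def)
  show "cmod (x 0) powr p + lp_norm p (backward_shift x) powr p = lp_norm p x powr p"
    unfolding lp_norm_powr[OF p b] lp_norm_powr[OF p x]
    using x suminf_split_head[of "\<lambda>i. cmod (x i) powr p"] by (simp add: lp_space_def backward_shift_def)
qed

lemma geom_seq_powr_sums:
  assumes "1 < a" "1 \<le> p"
  shows "(\<lambda>i. cmod (geom_seq a i) powr p) sums (a powr p / (1 - 1 / a powr p))"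
proof -
  have "cmod (geom_seq a i) powr p = a powr p * (1 / a powr p) ^ i" for i
  proof -
    have "cmod (geom_seq a i) = a * (1 / a) ^ i"
      using assms(1) by (simp add: geom_seq_def norm_mult norm_divide norm_power)
    then show ?thesis
      using assms(1)
      by (simp add: powr_mult powr_divide power_one_over powr_powr mult.commute flip: powr_realpow)
  qed
  moreover have "1 < a powr p"
    using assms by (simp add: gr_one_powr)
  then have "norm (1 / a powr p) < 1"
    by (simp add: divide_simps)
  ultimately show ?thesis
    using sums_mult[OF geometric_sums, of "1 / a powr p" "a powr p"] by simp
qed

lemma lp_complete:
  assumes p: "1 \<le> p" and s: "\<And>n. s n \<in> lp_space p"
    and cauchy: "\<And>e. 0 < e \<Longrightarrow> \<exists>K. \<forall>m\<ge>K. \<forall>n\<ge>K. lp_norm p (\<lambda>i. s m i - s n i) < e"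
  shows "\<exists>x\<in>lp_space p. (\<lambda>n. lp_norm p (\<lambda>i. s n i - x i)) \<longlonglongrightarrow> 0"
proof -
  have diff: "(\<lambda>i. x i - y i) \<in> lp_space p" if "x \<in> lp_space p" "y \<in> lp_space p" for x y
    using lp_minkowski[OF p that(1) lp_minus[OF that(2)]] by simp
  have coord: "cmod (s m i - s n i) \<le> lp_norm p (\<lambda>i. s m i - s n i)" for m n i
    using lp_coord[OF p diff[OF s s]] .
  have "Cauchy (\<lambda>n. s n i)" for i
  proof (rule CauchyI)
    show "\<exists>M. \<forall>m\<ge>M. \<forall>n\<ge>M. cmod (s m i - s n i) < e" if "0 < e" for e
      using cauchy[OF that] coord[of _ i] by (meson le_less_trans)
  qed
  then obtain x where x: "\<And>i. (\<lambda>n. s n i) \<longlonglongrightarrow> x i"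
    unfolding Cauchy_convergent_iff convergent_def by metis
  have near: "\<exists>K. \<forall>n\<ge>K. (\<lambda>i. s n i - x i) \<in> lp_space p \<and> lp_norm p (\<lambda>i. s n i - x i) \<le> e" if e: "0 < e" for e
  proof -
    obtain K where K: "\<And>m n. K \<le> m \<Longrightarrow> K \<le> n \<Longrightarrow> lp_norm p (\<lambda>i. s m i - s n i) < e"
      using cauchy[OF e] by blast
    have "(\<Sum>i<k. cmod (s n i - x i) powr p) \<le> e powr p" if n: "K \<le> n" for n k
    proof (rule LIMSEQ_le_const2)
      show "(\<lambda>m. \<Sum>i<k. cmod (s n i - s m i) powr p) \<longlonglongrightarrow> (\<Sum>i<k. cmod (s n i - x i) powr p)"
        using p by (intro tendsto_sum tendsto_powr' tendsto_intros x) auto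
      have "(\<Sum>i<k. cmod (s n i - s m i) powr p) \<le> e powr p" if m: "K \<le> m" for m
      proof -
        have "(\<Sum>i<k. cmod (s n i - s m i) powr p) \<le> (\<Sum>i. cmod (s n i - s m i) powr p)"
          using diff[OF s s, of n m] by (intro sum_le_suminf) (auto simp: lp_space_def)
        also have "\<dots> = lp_norm p (\<lambda>i. s n i - s m i) powr p"
          using lp_norm_powr[OF p diff[OF s s]] by simp
        also have "\<dots> \<le> e powr p"
          using K[OF n m] p lp_norm_nonneg by (intro powr_mono2) auto
        finally show ?thesis .
      qed
      then show "\<exists>M. \<forall>m\<ge>M. (\<Sum>i<k. cmod (s n i - s m i) powr p) \<le> e powr p"
        by blast
    qed
    then show ?thesis
      using lp_norm_leI[OF p, of e] e by (intro exI[of _ K]) auto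
  qed
  \<comment> \<open>The limit \<open>x\<close> is the difference of \<open>s k\<close> and
    \<open>s k - x\<close>, both in the space.\<close>
  obtain k where "(\<lambda>i. s k i - x i) \<in> lp_space p"
    using near[of 1] by auto
  from diff[OF s[of k] this] have xl: "x \<in> lp_space p"
    by simp
  show ?thesis
  proof (intro bexI[OF _ xl] LIMSEQ_I)
    fix e :: real
    assume e: "0 < e"
    then obtain K where "\<And>n. K \<le> n \<Longrightarrow> lp_norm p (\<lambda>i. s n i - x i) \<le> e / 2"
      using near[of "e / 2"] by auto
    then have "lp_norm p (\<lambda>i. s n i - x i) < e" if "K \<le> n" for n
      using that e by fastforce
    then show "\<exists>K. \<forall>n\<ge>K. norm (lp_norm p (\<lambda>i. s n i - x i) - 0) < e"
      using lp_norm_nonneg by (intro exI[of _ K]) simp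
  qed
qed

lemma normed_seq_space_lp:
  assumes p: "1 \<le> p"
  shows "normed_seq_space (lp_space p) (lp_norm p)"
proof (rule normed_seq_space.intro)
  show "Metric_space (lp_space p) (norm_dist (lp_space p) (lp_norm p))"
    by (rule Metric_space_lp[OF p])
next
  fix x y :: cseq and c :: complex
  assume x: "x \<in> lp_space p"
  show "(\<lambda>i. y i + x i) \<in> lp_space p" if "y \<in> lp_space p"
    using lp_minkowski[OF p that x] by simp
  show "lp_norm p (\<lambda>i. y i + x i) \<le> lp_norm p y + lp_norm p x" if "y \<in> lp_space p"
    using lp_minkowski[OF p that x] by simp
  show "(\<lambda>i. c * x i) \<in> lp_space p"
    using x by (simp add: lp_space_def norm_mult powr_mult summable_mult)
  have "(\<Sum>i. cmod (c * x i) powr p) = cmod c powr p * (\<Sum>i. cmod (x i) powr p)"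
    using x by (simp add: lp_space_def norm_mult powr_mult suminf_mult)
  then show "lp_norm p (\<lambda>i. c * x i) = cmod c * lp_norm p x"
    using p x by (simp add: lp_norm_def powr_mult powr_powr suminf_nonneg lp_space_def)
  show "cmod (x i) \<le> lp_norm p x" for i
    by (rule lp_coord[OF p x])
  show "backward_shift x \<in> lp_space p"
    by (rule lp_backward_shift[OF p x])
  have "lp_norm p (backward_shift x) powr p \<le> lp_norm p x powr p"
    using lp_backward_shift(2)[OF p x] powr_ge_zero[of "cmod (x 0)" p] by linarith
  then show "lp_norm p (backward_shift x) \<le> lp_norm p x"
    by (rule lp_norm_le_powrD[OF p])
  let ?s = "splice_at 1 (\<lambda>_. 0) x"
  have bs: "backward_shift ?s = x"
    by (simp add: backward_shift_def splice_at_def)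
  have "summable (\<lambda>i. cmod (?s (Suc i)) powr p)"
    using x by (simp add: splice_at_def lp_space_def)
  then show s: "?s \<in> lp_space p"
    unfolding lp_space_def using summable_Suc_iff[of "\<lambda>i. cmod (?s i) powr p"] by simp
  have "lp_norm p ?s powr p = lp_norm p x powr p"
    using lp_backward_shift(2)[OF p s] unfolding bs by (simp add: splice_at_def)
  then show "lp_norm p ?s \<le> lp_norm p x"
    by (intro lp_norm_le_powrD[OF p]) simp
  \<comment> \<open>The norm of the tail is the \<open>p\<close>-th root of the remainder of a
    convergent series.\<close>
  have "lp_norm p (zero_below m x) = ((\<Sum>i. cmod (x i) powr p) - (\<Sum>i<m. cmod (x i) powr p)) powr (1 / p)" for m
  proof -
    have "zero_below m x \<in> lp_space p"
      by (rule lp_solid[OF p x]) (simp add: zero_below_def)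
    then have "(\<Sum>i. cmod (zero_below m x i) powr p) = (\<Sum>i. cmod (x (i + m)) powr p)"
      using suminf_split_initial_segment[of "\<lambda>i. cmod (zero_below m x i) powr p" m]
      by (simp add: lp_space_def zero_below_def)
    then show ?thesis
      using suminf_split_initial_segment[of "\<lambda>i. cmod (x i) powr p" m] x
      by (simp add: lp_norm_def lp_space_def)
  qed
  moreover have "(\<lambda>m. (\<Sum>i. cmod (x i) powr p) - (\<Sum>i<m. cmod (x i) powr p)) \<longlonglongrightarrow> 0"
    using tendsto_diff[OF tendsto_const summable_LIMSEQ[of "\<lambda>i. cmod (x i) powr p"], of "\<Sum>i. cmod (x i) powr p"] x
    by (simp add: lp_space_def)
  moreover have "(\<Sum>i<m. cmod (x i) powr p) \<le> (\<Sum>i. cmod (x i) powr p)" for m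
    using x by (intro sum_le_suminf) (auto simp: lp_space_def)
  ultimately show "(\<lambda>m. lp_norm p (zero_below m x)) \<longlonglongrightarrow> 0"
    using p by (auto intro!: tendsto_zero_powrI[of _ _ "\<lambda>_. 1 / p" "1 / p"])
next
  fix x y :: cseq
  assume y: "y \<in> lp_space p" and le: "\<And>i. cmod (x i) \<le> cmod (y i)"
  show "x \<in> lp_space p" "lp_norm p x \<le> lp_norm p y"
    using lp_solid[OF p y le] .
next
  show "geom_seq a \<in> lp_space p" if "1 < a" for a
    using geom_seq_powr_sums[OF that p] by (auto simp: lp_space_def sums_iff)
qed (rule lp_complete[OF p])

text \<open>The fixed point \<open>geom_seq (2 powr (1 / p))\<close> has norm \<open>4 powr (1 / p)\<close>, which is the limit
  radius: with \<open>s = cmod (x 0) powr p\<close> and \<open>t\<close> the \<open>p\<close>-th power of the norm of the shifted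
  sequence, \<open>s + t \<le> 1\<close> gives \<open>s t \<le> 1 / 4\<close>.\<close>

lemma ex_geom_seq_lp:
  assumes p: "1 \<le> p" and d: "limit_radius 2 (lp_space p) (lp_norm p) shift_poly < d"
  shows "\<exists>a>1. lp_norm p (geom_seq a) < d"
proof -
  interpret normed_seq_space "lp_space p" "lp_norm p"
    by (rule normed_seq_space_lp[OF p])
  have "lp_norm p (shift_poly x) \<le> (1 / 4) powr (1 / p)" if x: "x \<in> lp_space p" "lp_norm p x \<le> 1" for x
  proof -
    define s t where "s = cmod (x 0) powr p" and "t = lp_norm p (backward_shift x) powr p"
    have "lp_norm p x powr p \<le> 1"
      using p x(2) lp_norm_nonneg powr_mono2[of p "lp_norm p x" 1] by simp
    then have "s + t \<le> 1" "0 \<le> s" "0 \<le> t"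
      using lp_backward_shift(2)[OF p x(1)] by (auto simp: s_def t_def)
    \<comment> \<open>From \<open>4 s t = (s + t)\<^sup>2 - (s - t)\<^sup>2\<close>.\<close>
    then have "4 * (s * t) \<le> 1 - (s - t)\<^sup>2"
      using power_mono[of "s + t" 1 2] by (simp add: power2_eq_square algebra_simps)
    then have st: "s * t \<le> 1 / 4"
      using zero_le_power2[of "s - t"] by linarith
    have "lp_norm p (shift_poly x) = cmod (x 0) * lp_norm p (backward_shift x)"
      unfolding shift_poly_eq by (rule N_scale[OF bshift[OF x(1)]])
    also have "\<dots> = (s * t) powr (1 / p)"
      using p lp_norm_nonneg by (simp add: s_def t_def powr_mult powr_powr)
    also have "\<dots> \<le> (1 / 4) powr (1 / p)"
      using p st \<open>0 \<le> s\<close> \<open>0 \<le> t\<close> by (intro powr_mono2) auto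
    finally show ?thesis .
  qed
  then have "1 / (1 / 4) powr (1 / p) \<le> limit_radius 2 (lp_space p) (lp_norm p) shift_poly"
    by (rule limit_radius_ge)
  moreover have "1 / (1 / 4) powr (1 / p) = 4 powr (1 / p)"
    by (simp add: powr_divide)
  ultimately have "4 powr (1 / p) < d"
    using d by simp
  \<comment> \<open>With \<open>t = a powr p\<close>, the \<open>p\<close>-th power of the norm of
    \<open>geom_seq a\<close> is \<open>t\<^sup>2 / (t - 1)\<close>, which is least at
    \<open>t = 2\<close>, with value 4.\<close>
  define a :: real where "a = 2 powr (1 / p)"
  have a: "1 < a" "a powr p = 2"
    using p by (auto simp: a_def powr_powr gr_one_powr)
  have "lp_norm p (geom_seq a) = 4 powr (1 / p)"
    using sums_unique[OF geom_seq_powr_sums[OF a(1) p]] by (simp add: lp_norm_def a(2))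
  then show ?thesis
    using a(1) \<open>4 powr (1 / p) < d\<close> by auto
qed

theorem theorem3p15:
  fixes X :: "cseq set" and N :: "cseq \<Rightarrow> real"
  assumes "(X = c0_space \<and> N = c0_norm) \<or>
           (\<exists>p::real. 1 \<le> p \<and> X = lp_space p \<and> N = lp_norm p)"
  defines "P \<equiv> shift_poly"
  defines "J \<equiv> julia_set X N P"
  shows "chaotic (subtopology (norm_topology X N) J) P \<and>
         (\<forall>x0\<in>J. dense_in (subtopology (norm_topology X N) J) (Orb P x0) \<longrightarrow>
            weakly_hypercyclic_vector X N P x0 \<and>
            (\<forall>d > limit_radius 2 X N P. d_hypercyclic_vector d X N P x0) \<and>
            (\<forall>\<Gamma>. 0 islimpt \<Gamma> \<longrightarrow> supercyclic_vector \<Gamma> X N P x0)) \<and>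
         (\<forall>\<Gamma>. \<not> bounded \<Gamma> \<longrightarrow> supercyclic \<Gamma> X N P)"
  unfolding J_def P_def
proof (rule normed_seq_space.julia_set_dynamics)
  show "normed_seq_space X N"
    using assms(1) normed_seq_space_c0 normed_seq_space_lp by auto
  show "\<exists>a>1. N (geom_seq a) < d" if "limit_radius 2 X N shift_poly < d" for d
    using assms(1) that ex_geom_seq_c0 ex_geom_seq_lp by auto
qed

end
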